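(* Let $n\ge1$ and let $T,S\in\mathbf{T}_n^2$, so that $\mathcal{V}_T,\mathcal{V}_S$ are orbital varieties of nilpotent order $2$ in $\mathfrak{sl}_n(\mathbb{C})$. Then $\mathcal{V}_S\subseteq\overline{\mathcal{V}}_T$ if and only if $\mathfrak{n}\cap^{w_S}\mathfrak{n}\subseteq\mathfrak{n}\cap^{w_T}\mathfrak{n}$.
   Context: A standard tableau is a filling of a Young diagram with $n$ boxes by $1,\dots,n$, each used once, increasing along rows and down columns. $\mathbf{T}_n^2$ is the set of standard tableaux with $n$ boxes and at most two columns, written $T=(T_1,T_2)$ with $T_i$ the $i$-th column ($T_2$ may be empty). Insertion: for a column $C$ and $j\notin C$, if some entry of $C$ is greater than $j$, then $j$ replaces the smallest such entry, which is bumped and inserted in the same way in the next column; otherwise $j$ is placed at the bottom of $C$ (an empty column receives $j$). $j\Rightarrow T$ is the tableau obtained by inserting $j$ into $T$ starting with the first column. For a permutation in word form $w=[a_1,\dots,a_n]$ (with $a_i=w(i)$), $T(w):=a_1\Rightarrow(a_2\Rightarrow(\cdots\Rightarrow(a_n)))$. Let $p_w(i)$ denote the position of the letter $i$ in $w$. Orbital varieties: let $G=SL_n(\mathbb{C})$ act on $\mathfrak{sl}_n(\mathbb{C})$ by conjugation, $B\subset G$ the subgroup of upper triangular matrices, $\mathfrak{n}$ the strictly upper triangular matrices; closures are Zariski closures. For $w\in\mathbf{S}_n$ let $\mathfrak{n}\cap^w\mathfrak{n}$ be the linear span of the matrix units $E_{i,j}$ with $i<j$ and $p_w(i)<p_w(j)$.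 There is a unique nilpotent orbit $\mathcal{O}_w$ with $\overline{G(\mathfrak{n}\cap^w\mathfrak{n})}=\overline{\mathcal{O}}_w$, and $\mathcal{V}_w:=\overline{B(\mathfrak{n}\cap^w\mathfrak{n})}\cap\mathcal{O}_w$ is an orbital variety, i.e. an irreducible component of $\mathcal{O}_w\cap\mathfrak{n}$; every orbital variety arises so. It is known that $\mathcal{V}_w=\mathcal{V}_y$ iff $T(w)=T(y)$; for a standard tableau $T$ put $\mathcal{V}_T:=\mathcal{V}_w$ for any $w$ with $T(w)=T$. The orbital varieties of nilpotent order 2 (all elements satisfy $X^2=0$) are the $\mathcal{V}_T$ with $T\in\mathbf{T}_n^2$. Deletion: let $T$ be a tableau with at most two columns and let $a$ be an entry of $T$ at a corner box (no neighbours to the right or below). If $a$ is in the first column, $T\Leftarrow a$ is $T$ with that box removed, and $a^T:=a$. If $a$ is in the second column, $T\Leftarrow a$ is obtained by deleting $a$ from the second column and replacing by $a$ the greatest entry $b$ of the first column with $b<a$; then $a^T:=b$. The word $w_T$: for $T\in\mathbf{T}_n^2$ put $T_{(n)}=T$ and, for $i=n,n-1,\dots,1$, let $z_i$ be the maximal entry of $T_{(i)}$, $a_i:=z_i^{T_{(i)}}$ and $T_{(i-1)}:=T_{(i)}\Leftarrow z_i$. Then $w_T:=[a_n,a_{n-1},\dots,a_1]$; it satisfies $T(w_T)=T$. *)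

theory Defs
  imports
    "Jordan_Normal_Form.VS_Connect"
    "HOL-Combinatorics.Multiset_Permutations"
begin

section \<open>Tableaux, insertion and deletion\<close>

text \<open>A tableau is the list of its nonempty columns, each read from top to bottom.  Absent columns
  are not stored, so a tableau \<open>(T\<^sub>1, T\<^sub>2)\<close> with empty \<open>T\<^sub>2\<close> is the list \<open>[T\<^sub>1]\<close>.\<close>

type_synonym tableau = "nat list list"

definition standard_tableau :: "nat \<Rightarrow> tableau \<Rightarrow> bool" where
  "standard_tableau n T \<longleftrightarrow>
     [] \<notin> set T \<and>
     distinct (concat T) \<and> set (concat T) = {1..n} \<and>
     (\<forall>C\<in>set T. sorted_wrt (<) C) \<and>
     (\<forall>i. Suc i < length T \<longrightarrow>
        length (T ! Suc i) \<le> length (T ! i) \<and>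
        (\<forall>r < length (T ! Suc i). T ! i ! r < T ! Suc i ! r))"

definition two_column_tableaux :: "nat \<Rightarrow> tableau set" where
  "two_column_tableaux n = {T. standard_tableau n T \<and> length T \<le> 2}"

fun column_insert :: "nat \<Rightarrow> tableau \<Rightarrow> tableau" where
  "column_insert j [] = [[j]]"
| "column_insert j (C # Cs) =
     (if \<exists>x\<in>set C. j < x then
        (let b = Min {x \<in> set C. j < x}
         in map (\<lambda>x. if x = b then j else x) C # column_insert b Cs)
      else (C @ [j]) # Cs)"

text \<open>The last letter of the word is inserted first.\<close>

definition tableau_of_word :: "nat list \<Rightarrow> tableau" where
  "tableau_of_word w = foldr column_insert w []"

text \<open>Columns are numbered from 0 here; a missing column is the empty list.\<close>

definition column :: "tableau \<Rightarrow> nat \<Rightarrow> nat list" where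
  "column T i = (if i < length T then T ! i else [])"

text \<open>The next two functions are \<open>a\<^sup>T\<close> and \<open>T \<Leftarrow> a\<close>, meant for a tableau with at most two columns and
  an entry \<open>a\<close> in a corner box.\<close>

definition ejected :: "tableau \<Rightarrow> nat \<Rightarrow> nat" where
  "ejected T a =
     (if a \<in> set (column T 0) then a else Max {b \<in> set (column T 0). b < a})"

definition delete_corner :: "tableau \<Rightarrow> nat \<Rightarrow> tableau" where
  "delete_corner T a = filter (\<lambda>C. C \<noteq> [])
     (if a \<in> set (column T 0) then [remove1 a (column T 0), column T 1]
      else [map (\<lambda>x. if x = ejected T a then a else x) (column T 0), remove1 a (column T 1)])"

text \<open>The numerical argument is the number of boxes of the tableau.\<close>

fun word_of_tableau :: "nat \<Rightarrow> tableau \<Rightarrow> nat list" where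
  "word_of_tableau 0 T = []"
| "word_of_tableau (Suc i) T =
     (let z = Max (set (concat T)) in ejected T z # word_of_tableau i (delete_corner T z))"


section \<open>Zariski closure in the space of square matrices\<close>

text \<open>Matrices are indexed from 0.  The complex polynomial functions in the \<open>n\<^sup>2\<close> matrix
  entries:\<close>

inductive_set polynomial_functions :: "nat \<Rightarrow> (complex mat \<Rightarrow> complex) set" for n :: nat where
  const: "(\<lambda>_. c) \<in> polynomial_functions n"
| entry: "i < n \<Longrightarrow> j < n \<Longrightarrow> (\<lambda>X. X $$ (i, j)) \<in> polynomial_functions n"
| add: "f \<in> polynomial_functions n \<Longrightarrow> g \<in> polynomial_functions n
          \<Longrightarrow> (\<lambda>X. f X + g X) \<in> polynomial_functions n"
| mult: "f \<in> polynomial_functions n \<Longrightarrow> g \<in> polynomial_functions n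
          \<Longrightarrow> (\<lambda>X. f X * g X) \<in> polynomial_functions n"

definition zariski_closed :: "nat \<Rightarrow> complex mat set \<Rightarrow> bool" where
  "zariski_closed n Z \<longleftrightarrow>
     (\<exists>F \<subseteq> polynomial_functions n. Z = {X \<in> carrier_mat n n. \<forall>f\<in>F. f X = 0})"

text \<open>The closure is taken in all \<open>n \<times> n\<close> matrices; for subsets of the closed subspace of traceless
  matrices this agrees with the closure taken there.\<close>

definition zariski_closure :: "nat \<Rightarrow> complex mat set \<Rightarrow> complex mat set" where
  "zariski_closure n S = (zariski_closed n) hull S"

lemma zariski_closure_iff:
  assumes "S \<subseteq> carrier_mat n n"
  shows "X \<in> zariski_closure n S \<longleftrightarrow>
    X \<in> carrier_mat n n \<and> (\<forall>f\<in>polynomial_functions n. (\<forall>Y\<in>S. f Y = 0) \<longrightarrow> f X = 0)"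
    (is "_ \<longleftrightarrow> ?R")
proof
  assume X: "X \<in> zariski_closure n S"
  let ?Z = "{X \<in> carrier_mat n n. \<forall>f\<in>{f \<in> polynomial_functions n. \<forall>Y\<in>S. f Y = 0}. f X = 0}"
  have "zariski_closed n ?Z" unfolding zariski_closed_def by blast
  moreover have "S \<subseteq> ?Z" using assms by blast
  ultimately have "zariski_closure n S \<subseteq> ?Z"
    unfolding zariski_closure_def by (rule hull_minimal[rotated])
  then show ?R using X by blast
next
  assume ?R
  then show "X \<in> zariski_closure n S"
    unfolding zariski_closure_def hull_def zariski_closed_def by blast
qed


section \<open>Orbital varieties\<close>

definition SL :: "nat \<Rightarrow> complex mat set" where
  "SL n = {g \<in> carrier_mat n n. det g = 1}"

definition Borel :: "nat \<Rightarrow> complex mat set" where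
  "Borel n = {g \<in> SL n. upper_triangular g}"

text \<open>The saturation of \<open>S\<close> under conjugation by \<open>H\<close>; here \<open>h\<close> is the inverse of \<open>g\<close>.\<close>

definition conjugates :: "nat \<Rightarrow> complex mat set \<Rightarrow> complex mat set \<Rightarrow> complex mat set" where
  "conjugates n H S =
     {g * X * h | g h X. g \<in> H \<and> h \<in> carrier_mat n n \<and> inverts_mat g h \<and> inverts_mat h g \<and> X \<in> S}"

text \<open>Nilpotent matrices are traceless, so these are the nilpotent orbits in the Lie algebra of
  \<open>SL n\<close>.\<close>

definition nilpotent_orbit :: "nat \<Rightarrow> complex mat set \<Rightarrow> bool" where
  "nilpotent_orbit n \<O> \<longleftrightarrow>
     (\<exists>X \<in> carrier_mat n n. (\<exists>k. X ^\<^sub>m k = 0\<^sub>m n n) \<and> \<O> = conjugates n (SL n) {X})"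

definition matrix_unit :: "nat \<Rightarrow> nat \<Rightarrow> nat \<Rightarrow> complex mat" where
  "matrix_unit n i j = mat n n (\<lambda>(r, s). if Suc r = i \<and> Suc s = j then 1 else 0)"

text \<open>The 1-based position of the letter \<open>i\<close> in a word containing it.\<close>

definition position :: "nat list \<Rightarrow> nat \<Rightarrow> nat" where
  "position w i = Suc (length (takeWhile (\<lambda>x. x \<noteq> i) w))"

text \<open>The space \<open>\<nn> \<inter>\<^sup>w \<nn>\<close>, for a permutation \<open>w\<close> in word form.\<close>

definition nil_inter :: "nat \<Rightarrow> nat list \<Rightarrow> complex mat set" where
  "nil_inter n w = LinearCombinations.module.span class_ring (module_mat TYPE(complex) n n)
     {matrix_unit n i j | i j. i \<in> {1..n} \<and> j \<in> {1..n} \<and> i < j \<and> position w i < position w j}"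

lemma nil_inter_eq:
  "nil_inter n w = {X \<in> carrier_mat n n. \<forall>r<n. \<forall>s<n.
     X $$ (r, s) \<noteq> 0 \<longrightarrow> r < s \<and> position w (Suc r) < position w (Suc s)}"
  (is "_ = ?Z")
proof
  let ?M = "module_mat TYPE(complex) n n"
  let ?U = "{matrix_unit n i j | i j. i \<in> {1..n} \<and> j \<in> {1..n} \<and> i < j \<and> position w i < position w j}"
  interpret V: vectorspace "class_ring :: complex ring" ?M by (rule matrix_vs)
  have U: "?U \<subseteq> carrier ?M" by (auto simp: module_mat_simps matrix_unit_def)
  define Q where "Q r s \<longleftrightarrow> r < s \<and> position w (Suc r) < position w (Suc s)" for r s
  define Z where "Z = ?Z"
  have Z_iff: "Y \<in> Z \<longleftrightarrow>
      Y \<in> carrier_mat n n \<and> (\<forall>r s. r < n \<longrightarrow> s < n \<longrightarrow> \<not> Q r s \<longrightarrow> Y $$ (r, s) = 0)" for Y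
    unfolding Z_def Q_def by blast
  have Z: "submodule (class_ring :: complex ring) Z ?M"
  proof (rule submodule.intro[OF V.module_axioms])
    show "Z \<subseteq> carrier ?M"
      using Z_iff by (auto simp: module_mat_simps)
    show "\<zero>\<^bsub>?M\<^esub> \<in> Z"
      by (simp add: module_mat_simps Z_iff)
    show "A \<oplus>\<^bsub>?M\<^esub> B \<in> Z" if "A \<in> Z" "B \<in> Z" for A B
      using that by (auto simp: module_mat_simps Z_iff)
    show "c \<odot>\<^bsub>?M\<^esub> A \<in> Z" if "A \<in> Z" for c A
      using that by (auto simp: module_mat_simps Z_iff)
  qed
  have "?U \<subseteq> Z"
    by (auto simp: Z_iff Q_def matrix_unit_def)
  then have "nil_inter n w \<subseteq> Z"
    unfolding nil_inter_def by (rule V.span_is_subset[OF _ Z])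
  then show "nil_inter n w \<subseteq> ?Z"
    unfolding Z_def .
  show "?Z \<subseteq> nil_inter n w"
  proof
    fix X assume X: "X \<in> ?Z"
    let ?S = "nil_inter n w"
    have S: "submodule (class_ring :: complex ring) ?S ?M"
      unfolding nil_inter_def by (rule V.span_is_submodule[OF U])
    have add: "A + B \<in> ?S" if "A \<in> ?S" "B \<in> ?S" for A B
      using submodule.m_closed[OF S that] by (simp add: module_mat_simps)
    have smult: "c \<cdot>\<^sub>m A \<in> ?S" if "A \<in> ?S" for A c
      using submodule.smult_closed[OF S, of c A] that by (simp add: module_mat_simps)
    have zero: "0\<^sub>m n n \<in> ?S"
      using submodule.zero_closed[OF S] by (simp add: module_mat_simps)
    have units: "?U \<subseteq> ?S"
      unfolding nil_inter_def by (rule V.in_own_span[OF U])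
    have "mat n n (\<lambda>p. if p \<in> A then X $$ p else 0) \<in> ?S"
      if "finite A" "A \<subseteq> {..<n} \<times> {..<n}" for A
      using that
    proof (induction A rule: finite_induct)
      case empty
      have "mat n n (\<lambda>p. if p \<in> {} then X $$ p else 0) = 0\<^sub>m n n" by (rule eq_matI) auto
      then show ?case using zero by simp
    next
      case (insert p A)
      obtain r s where p: "p = (r, s)" by (cases p)
      have rs: "r < n" "s < n" using insert.prems p by auto
      have IH: "mat n n (\<lambda>p. if p \<in> A then X $$ p else 0) \<in> ?S" using insert by auto
      have "X $$ (r, s) \<cdot>\<^sub>m matrix_unit n (Suc r) (Suc s) \<in> ?S"
      proof (cases "X $$ (r, s) = 0")
        case True
        have "X $$ (r, s) \<cdot>\<^sub>m matrix_unit n (Suc r) (Suc s) = 0\<^sub>m n n"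
          by (rule eq_matI) (auto simp: True matrix_unit_def)
        then show ?thesis using zero by simp
      next
        case False
        then have "r < s \<and> position w (Suc r) < position w (Suc s)" using X rs by blast
        then have "matrix_unit n (Suc r) (Suc s) \<in> ?U" using rs by force
        then show ?thesis using units smult by blast
      qed
      moreover have "mat n n (\<lambda>q. if q \<in> insert p A then X $$ q else 0) =
          X $$ (r, s) \<cdot>\<^sub>m matrix_unit n (Suc r) (Suc s) + mat n n (\<lambda>p. if p \<in> A then X $$ p else 0)"
        using insert.hyps(2) rs
        by (intro eq_matI) (auto simp: p matrix_unit_def)
      ultimately show ?case using add IH by simp
    qed
    from this[of "{..<n} \<times> {..<n}"]
    have "mat n n (\<lambda>p. if p \<in> {..<n} \<times> {..<n} then X $$ p else 0) \<in> ?S" by simp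
    moreover have "mat n n (\<lambda>p. if p \<in> {..<n} \<times> {..<n} then X $$ p else 0) = X"
      using X by (intro eq_matI) auto
    ultimately show "X \<in> ?S" by simp
  qed
qed

text \<open>The unique nilpotent orbit whose closure is that of the \<open>SL n\<close>-saturation of
  \<open>\<nn> \<inter>\<^sup>w \<nn>\<close>.\<close>

definition orbit_of_word :: "nat \<Rightarrow> nat list \<Rightarrow> complex mat set" where
  "orbit_of_word n w =
     (THE \<O>. nilpotent_orbit n \<O> \<and>
        zariski_closure n (conjugates n (SL n) (nil_inter n w)) = zariski_closure n \<O>)"

definition orbital_variety_of_word :: "nat \<Rightarrow> nat list \<Rightarrow> complex mat set" where
  "orbital_variety_of_word n w =
     zariski_closure n (conjugates n (Borel n) (nil_inter n w)) \<inter> orbit_of_word n w"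

text \<open>\<open>\<V>\<^sub>T\<close> is \<open>\<V>\<^sub>w\<close> for any permutation \<open>w\<close> with \<open>T(w) = T\<close>; it does not depend on the choice of \<open>w\<close>.\<close>

definition orbital_variety :: "nat \<Rightarrow> tableau \<Rightarrow> complex mat set" where
  "orbital_variety n T =
     orbital_variety_of_word n (SOME w. w \<in> permutations_of_set {1..n} \<and> tableau_of_word w = T)"

end

theory Submission
  imports Defs "Jordan_Normal_Form.Jordan_Normal_Form_Existence" "HOL-Library.Infinite_Set"
begin

text \<open>A Knuth move enlarges or shrinks \<open>\<nn> \<inter>\<^sup>w \<nn>\<close> by one matrix unit, and conjugation by an
  elementary unipotent matrix moves a generic element of the larger space into the smaller one.  So the
  closures of the \<open>B\<close>- and \<open>SL\<close>-saturations of \<open>\<nn> \<inter>\<^sup>w \<nn>\<close> depend only on \<open>T(w)\<close>, and \<open>\<V>\<^sub>T\<close> can be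
  computed from \<open>w\<^sub>T\<close>.  Generic elements of this space are square zero matrices of maximal rank, hence lie
  in one orbit, and \<open>\<V>\<^sub>T\<close> has the same closure as \<open>B(\<nn> \<inter>\<^sup>w \<nn>)\<close> for \<open>w = w\<^sub>T\<close>; this gives one direction.

  For the other direction read \<open>T\<close> as a parenthesis word with first column opening and second column
  closing.  If \<open>\<V>\<^sub>S\<close> lies in the closure of \<open>\<V>\<^sub>T\<close>, then the ranks of the lower left corners over a balanced
  interval of \<open>S\<close> force \<open>T\<close> to agree with \<open>S\<close> on that interval.  Every matrix unit in
  \<open>\<nn> \<inter>\<^sup>w \<nn>\<close> for \<open>w = w\<^sub>S\<close> sits in such an interval, and whether it belongs to the space can be read off
  from the restriction of the parenthesis word to the interval.\<close>

section \<open>Knuth equivalence and column insertion\<close>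

text \<open>The obstacle is that neither variety comes with equations: each is the closure of a
  saturation cut with an orbit that is only described, and the word behind it is arbitrary. Two
  devices keep the argument elementary. Irreducibility enters only for linear spaces: on a line,
  polynomials become univariate, and a product of them that vanishes identically has a zero factor.
  Ranks enter through two opposite certificates: a sum of few rank one matrices bounds the rank from
  above and is stable under conjugation, while a nonzero minor bounds it from below and is
  polynomial, so its vanishing passes to closures.

  Balanced intervals of \<open>S\<close> are the right test because the corner over one reaches rank
  half its length. For \<open>T\<close> an upper bound is enough: for every cut \<open>c\<close>,
  the rows of openings before \<open>c\<close> and the columns of closings from \<open>c\<close> on
  cover all possible entries.\<close>

inductive knuth_equiv :: "nat list \<Rightarrow> nat list \<Rightarrow> bool" where
  knuth_refl: "knuth_equiv w w"
| knuth_sym: "knuth_equiv w w' \<Longrightarrow> knuth_equiv w' w"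
| knuth_trans: "knuth_equiv w w' \<Longrightarrow> knuth_equiv w' w'' \<Longrightarrow> knuth_equiv w w''"
| bac_bca: "a < b \<Longrightarrow> b < c \<Longrightarrow> knuth_equiv (u @ [b, a, c] @ v) (u @ [b, c, a] @ v)"
| acb_cab: "a < b \<Longrightarrow> b < c \<Longrightarrow> knuth_equiv (u @ [a, c, b] @ v) (u @ [c, a, b] @ v)"

declare knuth_trans [trans]

lemma knuth_equiv_context:
  "knuth_equiv w w' \<Longrightarrow> knuth_equiv (p @ w @ q) (p @ w' @ q)"
proof (induction rule: knuth_equiv.induct)
  case (bac_bca a b c u v)
  then show ?case using knuth_equiv.bac_bca[of a b c "p @ u" "v @ q"] by simp
next
  case (acb_cab a b c u v)
  then show ?case using knuth_equiv.acb_cab[of a b c "p @ u" "v @ q"] by simp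
qed (blast intro: knuth_equiv.intros)+

lemma knuth_equiv_Cons: "knuth_equiv w w' \<Longrightarrow> knuth_equiv (x # w) (x # w')"
  using knuth_equiv_context[of w w' "[x]" "[]"] by simp

lemma knuth_equiv_append: "knuth_equiv w w' \<Longrightarrow> knuth_equiv (w @ q) (w' @ q)"
  using knuth_equiv_context[of w w' "[]" q] by simp

text \<open>The letter to the right of each passed \<open>x\<close> is the next entry of
  \<open>us\<close>, or \<open>b\<close> at the end. It lies strictly between \<open>j\<close> and
  \<open>x\<close>, which is the witness that \<open>acb_cab\<close> requires.\<close>

lemma knuth_move_small:
  "\<lbrakk>sorted_wrt (>) us; \<forall>x\<in>set us. b < x; j < b\<rbrakk> \<Longrightarrow> knuth_equiv (j # us @ [b]) (us @ [j, b])"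
proof (induction us)
  case Nil
  then show ?case by (simp add: knuth_refl)
next
  case (Cons x us)
  obtain y r where y: "us @ [b] = y # r" by (cases "us @ [b]") auto
  have "y \<in> set (us @ [b])" using y by simp
  then have "j < y" "y < x" using Cons.prems by auto
  then have "knuth_equiv (j # x # us @ [b]) (x # j # us @ [b])"
    using knuth_equiv.acb_cab[of j y x "[]" r] y by simp
  also have "knuth_equiv (x # j # us @ [b]) (x # us @ [j, b])"
    using Cons by (intro knuth_equiv_Cons) auto
  finally show ?case by simp
qed

text \<open>Here the witness stands on the left: \<open>b\<close> passes \<open>l\<close> because
  the letter before it lies strictly between \<open>l\<close> and \<open>b\<close>. That letter is
  \<open>j\<close> at first and afterwards the entry just passed, hence the generalisation over
  \<open>j\<close>.\<close>

lemma knuth_move_large: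
  "\<lbrakk>sorted_wrt (>) ls; \<forall>x\<in>set ls. x < j; j < b\<rbrakk> \<Longrightarrow> knuth_equiv (j # b # ls) (j # ls @ [b])"
proof (induction ls arbitrary: j)
  case Nil
  then show ?case by (simp add: knuth_refl)
next
  case (Cons l ls)
  have "knuth_equiv (j # b # l # ls) (j # l # b # ls)"
    using knuth_equiv.bac_bca[of l j b "[]" ls] Cons.prems by (auto intro: knuth_sym)
  also have "knuth_equiv (l # b # ls) (l # ls @ [b])"
    using Cons by auto
  then have "knuth_equiv (j # l # b # ls) (j # l # ls @ [b])"
    by (rule knuth_equiv_Cons)
  finally show ?case by simp
qed

lemma sorted_split_bumped:
  fixes C :: "nat list"
  assumes C: "sorted_wrt (<) C" and j: "j \<notin> set C" and ex: "\<exists>x\<in>set C. j < x"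
    and b: "b = Min {x \<in> set C. j < x}"
  obtains L U where "C = L @ b # U" "\<forall>x\<in>set L. x < j" "j < b" "\<forall>x\<in>set U. b < x"
    "map (\<lambda>x. if x = b then j else x) C = L @ j # U"
proof -
  have "b \<in> {x \<in> set C. j < x}" unfolding b using ex by (intro Min_in) auto
  then have bC: "b \<in> set C" "j < b" by auto
  have bmin: "b \<le> x" if "x \<in> set C" "j < x" for x
    unfolding b using that by (intro Min_le) auto
  obtain L U where LU: "C = L @ b # U" using bC by (auto dest: split_list)
  have L: "x < b" if "x \<in> set L" for x using C that unfolding LU by (auto simp: sorted_wrt_append)
  have U: "\<forall>x\<in>set U. b < x" using C unfolding LU by (auto simp: sorted_wrt_append)
  have Lj: "x < j" if "x \<in> set L" for x
    using bmin[of x] L[OF that] j that LU by (cases "j < x") (auto simp: not_less le_less)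
  have "map (\<lambda>x. if x = b then j else x) C = L @ j # U"
    using L[of b] U unfolding LU by (auto intro!: map_idI)
  then show thesis using that[of L U] LU U Lj bC by blast
qed

definition reading_word :: "tableau \<Rightarrow> nat list" where
  "reading_word T = concat (map rev T)"

text \<open>The column \<open>L @ b # U\<close> stands in the reading word as
  \<open>rev U @ b # rev L\<close>. With \<open>j\<close> in front, the first auxiliary move carries
  \<open>j\<close> through the larger entries up to \<open>b\<close>, the second carries
  \<open>b\<close> out through the smaller ones. What remains is the new column followed by
  \<open>b\<close>, ready for the next column. Sortedness, distinctness and content are carried
  along for the induction.\<close>

lemma column_insert_knuth:
  assumes "\<forall>C\<in>set T. sorted_wrt (<) C" "distinct (j # concat T)"
  shows "(\<forall>C\<in>set (column_insert j T). sorted_wrt (<) C)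
    \<and> distinct (concat (column_insert j T))
    \<and> set (concat (column_insert j T)) = insert j (set (concat T))
    \<and> knuth_equiv (j # reading_word T) (reading_word (column_insert j T))"
  using assms
proof (induction T arbitrary: j)
  case Nil
  then show ?case by (simp add: reading_word_def knuth_refl)
next
  case (Cons C Cs)
  show ?case
  proof (cases "\<exists>x\<in>set C. j < x")
    case False
    then have "x < j" if "x \<in> set C" for x using that Cons.prems(2) by (auto simp: not_less le_less)
    then show ?thesis using False Cons.prems
      by (auto simp: reading_word_def knuth_refl sorted_wrt_append)
  next
    case True
    define b where b: "b = Min {x \<in> set C. j < x}"
    have sC: "sorted_wrt (<) C" and jC: "j \<notin> set C" using Cons.prems by auto
    obtain L U where LU: "C = L @ b # U" "\<forall>x\<in>set L. x < j" "j < b" "\<forall>x\<in>set U. b < x"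
      and mp: "map (\<lambda>x. if x = b then j else x) C = L @ j # U"
      using sorted_split_bumped[OF sC jC True b] by blast
    have ins: "column_insert j (C # Cs) = (L @ j # U) # column_insert b Cs"
      using True mp by (simp add: Let_def b[symmetric])
    have IH: "(\<forall>C\<in>set (column_insert b Cs). sorted_wrt (<) C)
      \<and> distinct (concat (column_insert b Cs))
      \<and> set (concat (column_insert b Cs)) = insert b (set (concat Cs))
      \<and> knuth_equiv (b # reading_word Cs) (reading_word (column_insert b Cs))"
      using Cons.prems LU(1) by (intro Cons.IH) auto
    have sL: "sorted_wrt (<) L" and sU: "sorted_wrt (<) U"
      using sC unfolding LU(1) by (auto simp: sorted_wrt_append)
    have "knuth_equiv (j # rev U @ [b]) (rev U @ [j, b])"
      using sU LU by (intro knuth_move_small) (auto simp: sorted_wrt_rev)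
    from knuth_equiv_append[OF this, of "rev L"]
    have "knuth_equiv (j # rev C) (rev U @ j # b # rev L)" using LU(1) by simp
    also have "knuth_equiv \<dots> (rev U @ j # rev L @ [b])"
      using knuth_equiv_context[OF knuth_move_large[of "rev L" j b], of "rev U" "[]"] sL LU
      by (auto simp: sorted_wrt_rev)
    finally have "knuth_equiv (j # rev C) (rev (L @ j # U) @ [b])" by simp
    from knuth_equiv_append[OF this, of "reading_word Cs"]
    have "knuth_equiv (j # reading_word (C # Cs)) (rev (L @ j # U) @ b # reading_word Cs)"
      by (simp add: reading_word_def)
    also have "knuth_equiv \<dots> (rev (L @ j # U) @ reading_word (column_insert b Cs))"
      using IH knuth_equiv_context[of _ _ "rev (L @ j # U)" "[]"] by auto
    finally
    have "knuth_equiv (j # reading_word (C # Cs)) (reading_word (column_insert j (C # Cs)))"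
      unfolding ins by (simp add: reading_word_def)
    moreover have "sorted_wrt (<) (L @ j # U)"
      using sL sU LU by (fastforce simp: sorted_wrt_append)
    ultimately show ?thesis unfolding ins
      using IH Cons.prems LU(1) by auto
  qed
qed

lemma knuth_equiv_reading_word:
  assumes "distinct w"
  shows "knuth_equiv w (reading_word (tableau_of_word w))"
proof -
  have "(\<forall>C\<in>set (tableau_of_word w). sorted_wrt (<) C) \<and> distinct (concat (tableau_of_word w))
    \<and> set (concat (tableau_of_word w)) = set w \<and> knuth_equiv w (reading_word (tableau_of_word w))"
    using assms
  proof (induction w)
    case Nil
    then show ?case by (simp add: tableau_of_word_def reading_word_def knuth_refl)
  next
    case (Cons a w)
    then have IH: "\<forall>C\<in>set (tableau_of_word w). sorted_wrt (<) C" "distinct (concat (tableau_of_word w))"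
      "set (concat (tableau_of_word w)) = set w" "knuth_equiv w (reading_word (tableau_of_word w))"
      by auto
    have eq: "tableau_of_word (a # w) = column_insert a (tableau_of_word w)"
      by (simp add: tableau_of_word_def)
    have "distinct (a # concat (tableau_of_word w))"
      using IH(2,3) Cons.prems by (metis distinct.simps(2))
    from column_insert_knuth[OF IH(1) this]
    show ?case unfolding eq
      using IH knuth_equiv_Cons[OF IH(4), of a] by (auto intro: knuth_trans)
  qed
  then show ?thesis by blast
qed

lemma knuth_equiv_if_same_tableau:
  assumes "distinct w" "distinct w'" "tableau_of_word w = tableau_of_word w'"
  shows "knuth_equiv w w'"
  using knuth_equiv_reading_word[OF assms(1)] knuth_equiv_reading_word[OF assms(2)] assms(3)
  by (metis knuth_sym knuth_trans)


section \<open>Tableaux with at most two columns\<close>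

text \<open>The third argument is \<open>w\<^sub>T\<close>, built up by increasing maximal entries.  A letter \<open>z\<close> of the second
  column contributes two letters: its deletion ejects \<open>b\<close> and puts \<open>z\<close> at the bottom of the first column,
  from where it is removed next.\<close>

inductive two_columns :: "nat list \<Rightarrow> nat list \<Rightarrow> nat list \<Rightarrow> bool" where
  empty: "two_columns [] [] []"
| single: "\<lbrakk>two_columns C D w; \<forall>x\<in>set C \<union> set D. x < z\<rbrakk> \<Longrightarrow> two_columns (C @ [z]) D (z # w)"
| pair: "\<lbrakk>two_columns C D w; \<forall>x\<in>set C. x < b; \<forall>x\<in>set D. x < z; b \<notin> set D; b < z\<rbrakk>
    \<Longrightarrow> two_columns (C @ [b]) (D @ [z]) (b # z # w)"

definition tableau_of_columns :: "nat list \<Rightarrow> nat list \<Rightarrow> tableau" where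
  "tableau_of_columns C D = filter (\<lambda>C. C \<noteq> []) [C, D]"

text \<open>The last entry \<open>b\<close> of the first column decides between the rules: if it
  exceeds the whole second column it is the maximum and \<open>single\<close> applies; otherwise the
  last entry of \<open>D\<close> is the maximum and \<open>b\<close> is the entry that its deletion
  ejects.\<close>

lemma two_columns_exists:
  assumes "sorted_wrt (<) C" "sorted_wrt (<) D" "distinct (C @ D)" "length D \<le> length C"
    "\<forall>r<length D. C ! r < D ! r"
  shows "\<exists>w. two_columns C D w"
  using assms
proof (induction "length C + length D" arbitrary: C D rule: less_induct)
  case less
  show ?case
  proof (cases C rule: rev_cases)
    case Nil
    then show ?thesis using less.prems two_columns.empty by auto
  next
    case (snoc P b)
    have P: "sorted_wrt (<) P" "\<forall>x\<in>set P. x < b" using less.prems(1) snoc by (auto simp: sorted_wrt_append)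
    show ?thesis
    proof (cases "\<forall>x\<in>set D. x < b")
      case True
      \<comment> \<open>If the box of \<open>b\<close> had a right neighbour, that entry would
        exceed \<open>b\<close>.\<close>
      have "length D \<le> length P"
      proof (rule ccontr)
        assume "\<not> length D \<le> length P"
        then have l: "length P < length D" by simp
        then have "b < D ! length P" using less.prems(5) snoc by (metis nth_append_length)
        then show False using True l by (meson nth_mem not_less_iff_gr_or_eq)
      qed
      moreover have "\<forall>r<length D. P ! r < D ! r"
        using less.prems(5) \<open>length D \<le> length P\<close> snoc by (auto simp: nth_append)
      ultimately obtain w where "two_columns P D w"
        using less.hyps[of P D] less.prems P snoc by auto
      then show ?thesis using two_columns.single[of P D w b] True P snoc by auto
    next
      case False
      then obtain y where y: "y \<in> set D" "\<not> y < b" by blast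
      have "y \<noteq> b" using y less.prems(3) snoc by auto
      with y have by_: "b < y" by simp
      obtain Q z where Q: "D = Q @ [z]" using y by (cases D rule: rev_cases) auto
      have sQ: "sorted_wrt (<) Q" "\<forall>x\<in>set Q. x < z" using less.prems(2) Q by (auto simp: sorted_wrt_append)
      have bz: "b < z" using y by_ sQ Q by auto
      have "\<forall>r<length Q. P ! r < Q ! r"
      proof (intro allI impI)
        fix r assume r: "r < length Q"
        then have "r < length P" "r < length D" using less.prems(4) snoc Q by auto
        then show "P ! r < Q ! r" using less.prems(5) r snoc Q by (metis nth_append)
      qed
      then obtain w where "two_columns P Q w"
        using less.hyps[of P Q] less.prems P sQ snoc Q by auto
      then show ?thesis using two_columns.pair[of P Q w b z] bz sQ P less.prems(3) snoc Q by auto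
    qed
  qed
qed

lemma two_columns_basic:
  assumes "two_columns C D w"
  shows "distinct w" "set w = set C \<union> set D" "set C \<inter> set D = {}"
    "length w = length C + length D" "length D \<le> length C"
  using assms by (induction rule: two_columns.induct) force+

lemma column_insert_greatest:
  assumes "\<forall>x\<in>set C. x < z" "length D \<le> length C"
  shows "column_insert z (tableau_of_columns C D) = tableau_of_columns (C @ [z]) D"
proof -
  have "\<not> (\<exists>x\<in>set C. z < x)" using assms(1) by (meson less_asym)
  then show ?thesis using assms(2) by (cases "C = []") (simp_all add: tableau_of_columns_def)
qed

text \<open>In the \<open>pair\<close> case \<open>z\<close> first lands at the bottom of the first
  column. It is then the only entry there greater than \<open>b\<close>, so \<open>b\<close> takes
  its box and sends it to the bottom of the second column.\<close>

lemma tableau_of_word_two_columns: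
  "two_columns C D w \<Longrightarrow> tableau_of_word w = tableau_of_columns C D"
proof (induction rule: two_columns.induct)
  case empty
  then show ?case by (simp add: tableau_of_word_def tableau_of_columns_def)
next
  case (single C D w z)
  note tw = two_columns_basic[OF single.hyps(1)]
  have "column_insert z (tableau_of_columns C D) = tableau_of_columns (C @ [z]) D"
    using single.hyps(2) tw(5) by (intro column_insert_greatest) auto
  then show ?case using single by (simp add: tableau_of_word_def)
next
  case (pair C D w b z)
  note tw = two_columns_basic[OF pair.hyps(1)]
  have C: "\<forall>x\<in>set C. x < z" using pair.hyps by force
  have zC: "z \<notin> set C" using C by blast
  have 1: "column_insert z (tableau_of_columns C D) = tableau_of_columns (C @ [z]) D"
    using C tw(5) by (intro column_insert_greatest) auto
  have ms: "{x \<in> set (C @ [z]). b < x} = {z}" using pair.hyps by force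
  have mp: "map (\<lambda>x. if x = z then b else x) (C @ [z]) = C @ [b]"
    using zC by (auto intro!: map_idI)
  have ex: "\<exists>x\<in>set (C @ [z]). b < x" using pair.hyps(5) by auto
  have D: "column_insert z (filter (\<lambda>C. C \<noteq> []) [D]) = [D @ [z]]"
    using pair.hyps(3) by (cases "D = []") force+
  have "column_insert b (tableau_of_columns (C @ [z]) D)
      = column_insert b ((C @ [z]) # filter (\<lambda>C. C \<noteq> []) [D])"
    by (simp add: tableau_of_columns_def)
  also have "\<dots> = (C @ [b]) # column_insert z (filter (\<lambda>C. C \<noteq> []) [D])"
    by (subst column_insert.simps(2)) (simp only: ex ms mp if_True Let_def Min_singleton)
  also have "\<dots> = tableau_of_columns (C @ [b]) (D @ [z])"
    unfolding D by (simp add: tableau_of_columns_def)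
  finally show ?case using pair.IH 1 by (simp add: tableau_of_word_def)
qed

lemma column_tableau_of_columns:
  assumes "length D \<le> length C"
  shows "column (tableau_of_columns C D) 0 = C" "column (tableau_of_columns C D) 1 = D"
    "set (concat (tableau_of_columns C D)) = set C \<union> set D"
  using assms by (cases "C = []"; cases "D = []"; simp add: column_def tableau_of_columns_def)+

lemma word_of_tableau_two_columns:
  "two_columns C D w \<Longrightarrow> word_of_tableau (length w) (tableau_of_columns C D) = w"
proof (induction rule: two_columns.induct)
  case empty
  then show ?case by simp
next
  case (single C D w z)
  note tw = two_columns_basic[OF single.hyps(1)]
  have col: "column (tableau_of_columns (C @ [z]) D) 0 = C @ [z]"
    "column (tableau_of_columns (C @ [z]) D) 1 = D"
    "set (concat (tableau_of_columns (C @ [z]) D)) = set (C @ [z]) \<union> set D"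
    using tw(5) by (intro column_tableau_of_columns; simp)+
  have mx: "Max (set (C @ [z]) \<union> set D) = z"
    using single.hyps(2) by (intro Max_eqI) (auto intro: less_imp_le)
  have "z \<notin> set C" using single.hyps(2) by blast
  then have "remove1 z (C @ [z]) = C" by (simp add: remove1_append)
  then have "delete_corner (tableau_of_columns (C @ [z]) D) z = tableau_of_columns C D"
    "ejected (tableau_of_columns (C @ [z]) D) z = z"
    unfolding delete_corner_def ejected_def col by (simp_all add: tableau_of_columns_def)
  then show ?case using single.IH by (simp only: length_Cons word_of_tableau.simps Let_def col mx)
next
  case (pair C D w b z)
  note tw = two_columns_basic[OF pair.hyps(1)]
  have Cz: "\<forall>x\<in>set C. x < z" using pair.hyps by force
  have zC: "z \<notin> set C" using Cz by blast
  have zD: "z \<notin> set D" using pair.hyps by blast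
  define T where "T = tableau_of_columns (C @ [b]) (D @ [z])"
  have col: "column T 0 = C @ [b]" "column T 1 = D @ [z]"
    "set (concat T) = set (C @ [b]) \<union> set (D @ [z])"
    unfolding T_def using tw(5) by (intro column_tableau_of_columns; simp)+
  have mx: "Max (set (C @ [b]) \<union> set (D @ [z])) = z"
    using pair.hyps Cz by (intro Max_eqI) (auto intro: less_imp_le)
  have zn: "z \<notin> set (C @ [b])" using zC pair.hyps(5) by auto
  have e: "ejected T z = b"
    unfolding ejected_def col using zn pair.hyps Cz
    by (auto intro!: Max_eqI intro: less_imp_le)
  have bC: "b \<notin> set C" using pair.hyps(2) by blast
  have mp: "map (\<lambda>x. if x = b then z else x) (C @ [b]) = C @ [z]"
    using bC by (auto intro!: map_idI)
  have rm: "remove1 z (D @ [z]) = D" using zD by (simp add: remove1_append)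
  have d: "delete_corner T z = tableau_of_columns (C @ [z]) D"
    unfolding delete_corner_def col e using zn mp rm by (simp only: if_False tableau_of_columns_def)
  have col': "column (tableau_of_columns (C @ [z]) D) 0 = C @ [z]"
    "column (tableau_of_columns (C @ [z]) D) 1 = D"
    "set (concat (tableau_of_columns (C @ [z]) D)) = set (C @ [z]) \<union> set D"
    using tw(5) by (intro column_tableau_of_columns; simp)+
  have mx': "Max (set (C @ [z]) \<union> set D) = z"
    using pair.hyps Cz by (intro Max_eqI) (auto intro: less_imp_le)
  have "remove1 z (C @ [z]) = C" using zC by (simp add: remove1_append)
  then have "delete_corner (tableau_of_columns (C @ [z]) D) z = tableau_of_columns C D"
    "ejected (tableau_of_columns (C @ [z]) D) z = z"
    unfolding delete_corner_def ejected_def col' by (simp_all add: tableau_of_columns_def)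
  then show ?case unfolding T_def[symmetric]
    using pair.IH by (simp only: length_Cons word_of_tableau.simps Let_def col mx e d col' mx')
qed

lemma two_column_tableaux_cases:
  assumes "T \<in> two_column_tableaux n"
  obtains C D w where "T = tableau_of_columns C D" "two_columns C D w" "set w = {1..n}"
    "w = word_of_tableau n T"
proof -
  have std: "[] \<notin> set T" "distinct (concat T)" "set (concat T) = {1..n}"
    "\<forall>C\<in>set T. sorted_wrt (<) C" "length T \<le> 2"
    and nb: "\<And>i. Suc i < length T \<Longrightarrow> length (T ! Suc i) \<le> length (T ! i) \<and>
        (\<forall>r < length (T ! Suc i). T ! i ! r < T ! Suc i ! r)"
    using assms unfolding two_column_tableaux_def standard_tableau_def by auto
  have "\<exists>C D w. T = tableau_of_columns C D \<and> two_columns C D w"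
  proof -
    consider "T = []" | C where "T = [C]" | C D where "T = [C, D]"
      using std(5) by (cases T; cases "tl T"; cases "tl (tl T)") auto
    then show ?thesis
    proof cases
      case 1
      then show ?thesis using two_columns.empty by (auto simp: tableau_of_columns_def)
    next
      case (2 C)
      then obtain w where "two_columns C [] w"
        using two_columns_exists[of C "[]"] std(2,4) by auto
      moreover have "T = tableau_of_columns C []" using 2 std(1) by (simp add: tableau_of_columns_def)
      ultimately show ?thesis by blast
    next
      case (3 C D)
      then obtain w where "two_columns C D w"
        using nb[of 0] std(2,4) two_columns_exists[of C D] by auto
      moreover have "T = tableau_of_columns C D" using 3 std(1) by (auto simp: tableau_of_columns_def)
      ultimately show ?thesis by blast
    qed
  qed
  then obtain C D w where *: "T = tableau_of_columns C D" "two_columns C D w" by blast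
  note tw = two_columns_basic[OF *(2)]
  have sw: "set w = {1..n}" using std(3) tw(2) column_tableau_of_columns(3)[OF tw(5)] *(1) by simp
  have "length w = n" using sw distinct_card[OF tw(1)] by simp
  then show thesis using that[of C D w] * sw word_of_tableau_two_columns[OF *(2)] by metis
qed

section \<open>Increasing pairs of the word as a counting condition on the two columns\<close>

text \<open>Call \<open>z\<close> the partner of \<open>b\<close> when a \<open>pair\<close> step of
  \<open>two_columns\<close> adds them together. For the two column sets the condition says that
  \<open>x\<close> has a partner and that \<open>y\<close> is a letter of \<open>E\<close> above
  \<open>x\<close> and at most that partner. The counting form is chosen because it sees only the
  letters between \<open>x\<close> and \<open>m\<close>, so it survives when two tableaux agree
  merely on an interval.\<close>

definition linked :: "nat set \<Rightarrow> nat set \<Rightarrow> nat \<Rightarrow> nat \<Rightarrow> bool" where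
  "linked A E x y \<longleftrightarrow> x \<in> A \<and> y \<in> E \<and> x < y \<and> (\<exists>m\<ge>y. card (A \<inter> {x..m}) \<le> card (E \<inter> {y..m}))"

lemma position_Cons: "position (z # w) x = (if x = z then 1 else Suc (position w x))"
  by (simp add: position_def)

lemma position_pos: "position w x > 0"
  by (simp add: position_def)

lemma card_insert_Int:
  "finite A \<Longrightarrow> z \<notin> A \<Longrightarrow> card (insert z A \<inter> I) = card (A \<inter> I) + (if z \<in> I then 1 else 0)"
  by (auto simp: Int_insert_left)

lemma linked_insert_left:
  assumes "finite A" "z \<notin> E" "\<forall>x\<in>A \<union> E. x < z"
  shows "linked (insert z A) E x y \<longleftrightarrow> linked A E x y"
proof -
  have z: "z \<notin> A" using assms(3) by blast
  note ci = card_insert_Int[OF assms(1) z]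
  show ?thesis
  proof
    assume "linked (insert z A) E x y"
    then obtain m where m: "x \<in> insert z A" "y \<in> E" "x < y" "m \<ge> y"
      "card (insert z A \<inter> {x..m}) \<le> card (E \<inter> {y..m})" unfolding linked_def by blast
    have "x \<noteq> z" using m(2,3) assms(3) by (metis UnCI less_asym)
    moreover have "card (A \<inter> {x..m}) \<le> card (E \<inter> {y..m})" using m(5) unfolding ci by simp
    ultimately show "linked A E x y" using m unfolding linked_def by blast
  next
    assume "linked A E x y"
    then obtain m where m: "x \<in> A" "y \<in> E" "x < y" "m \<ge> y"
      "card (A \<inter> {x..m}) \<le> card (E \<inter> {y..m})" unfolding linked_def by blast
    \<comment> \<open>Nothing in \<open>A\<close> or \<open>E\<close> lies above
      \<open>z - 1\<close>, so stopping the window there keeps both counts and leaves the new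
      \<open>z\<close> outside.\<close>
    define m' where "m' = min m (z - 1)"
    have "y < z" using m assms(3) by blast
    have "t \<le> z - 1" if "t \<in> A \<union> E" for t
    proof -
      have "t < z" using assms(3) that by blast
      then show ?thesis by simp
    qed
    then have "E \<inter> {y..m} = E \<inter> {y..m'}" "A \<inter> {x..m} = A \<inter> {x..m'}"
      unfolding m'_def by auto
    moreover have "z \<notin> {x..m'}" "m' \<ge> y" unfolding m'_def using m \<open>y < z\<close> by auto
    ultimately show "linked (insert z A) E x y" unfolding linked_def ci
      using m by (intro conjI exI[of _ m']) auto
  qed
qed

lemma linked_insert_both:
  assumes fin: "finite A" "finite E" and b: "\<forall>x\<in>A. x < b" "b \<notin> E" "b < z" and z: "\<forall>x\<in>E. x < z"
  shows "linked (insert b A) (insert z E) x y \<longleftrightarrow>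
    x = b \<and> y \<in> insert z E \<and> b < y \<or> linked A E x y"
proof -
  have nb: "b \<notin> A" and nz: "z \<notin> E" using b z by blast+
  note ciA = card_insert_Int[OF fin(1) nb] and ciE = card_insert_Int[OF fin(2) nz]
  show ?thesis
  proof (cases "x = b")
    case True
    have "A \<inter> {b..z} = {}" using b(1) by auto
    then have "card (insert b A \<inter> {b..z}) \<le> card (insert z E \<inter> {y..z})" if "y \<le> z"
      unfolding ciA ciE using that b(3) by simp
    moreover have "y \<le> z" if "y \<in> insert z E" using that z by auto
    ultimately have "linked (insert b A) (insert z E) b y \<longleftrightarrow> y \<in> insert z E \<and> b < y"
      unfolding linked_def using b(3) by blast
    moreover have "\<not> linked A E b y" using nb unfolding linked_def by blast
    ultimately show ?thesis using True by blast
  next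
    case False
    show ?thesis
    proof
      assume "linked (insert b A) (insert z E) x y"
      then obtain m where m: "x \<in> A" "y \<in> insert z E" "x < y" "m \<ge> y"
        "card (insert b A \<inter> {x..m}) \<le> card (insert z E \<inter> {y..m})"
        using False unfolding linked_def by blast
      have xb: "x < b" using m b by blast
      \<comment> \<open>For \<open>y = z\<close> the closing side counts only \<open>z\<close>,
        while the opening side already counts both \<open>x\<close> and \<open>b\<close>.\<close>
      have "y \<noteq> z"
      proof
        assume y: "y = z"
        have "E \<inter> {y..m} = {}" using z y by auto
        moreover have "x \<in> A \<inter> {x..m}" using m y by auto
        then have "card (A \<inter> {x..m}) > 0" using fin by (auto simp: card_gt_0_iff)
        ultimately show False using m(4,5) xb b y unfolding ciA ciE by simp
      qed
      moreover have "card (A \<inter> {x..m}) \<le> card (E \<inter> {y..m})"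
        using m(4,5) xb b(3) unfolding ciA ciE by (auto split: if_splits)
      ultimately show "x = b \<and> y \<in> insert z E \<and> b < y \<or> linked A E x y"
        using m unfolding linked_def by blast
    next
      assume "x = b \<and> y \<in> insert z E \<and> b < y \<or> linked A E x y"
      then obtain m where m: "x \<in> A" "y \<in> E" "x < y" "m \<ge> y"
        "card (A \<inter> {x..m}) \<le> card (E \<inter> {y..m})" using False unfolding linked_def by blast
      have yz: "y < z" using m z by blast
      have "\<exists>m\<ge>y. card (insert b A \<inter> {x..m}) \<le> card (insert z E \<inter> {y..m})"
      proof (cases "m < b")
        case True
        then show ?thesis unfolding ciA ciE using m by (intro exI[of _ m]) auto
      next
        case mb: False
        \<comment> \<open>Once \<open>b\<close> is in the window it has to be offset by
          \<open>z\<close>, so the window is extended to reach \<open>z\<close>; the old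
          \<open>A\<close> lies below \<open>b\<close> and adds nothing.\<close>
        have "A \<inter> {x..max m z} = A \<inter> {x..m}" using b(1) mb by force
        moreover have "card (E \<inter> {y..m}) \<le> card (E \<inter> {y..max m z})"
          using fin by (intro card_mono) auto
        ultimately show ?thesis unfolding ciA ciE using m yz by (intro exI[of _ "max m z"]) auto
      qed
      then show "linked (insert b A) (insert z E) x y" using m unfolding linked_def by blast
    qed
  qed
qed

definition increasing_pair :: "nat list \<Rightarrow> nat \<Rightarrow> nat \<Rightarrow> bool" where
  "increasing_pair w x y \<longleftrightarrow> x \<in> set w \<and> y \<in> set w \<and> x < y \<and> position w x < position w y"

lemma increasing_pair_Cons:
  assumes "z \<notin> set w"
  shows "increasing_pair (z # w) x y \<longleftrightarrow> x = z \<and> y \<in> set w \<and> z < y \<or> increasing_pair w x y"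
  using assms position_pos[of w] unfolding increasing_pair_def position_Cons by auto

text \<open>Both sides obey the same recursion, since a letter put in front of the word forms
  increasing pairs exactly with the larger letters behind it.\<close>

lemma increasing_pair_iff_linked:
  "two_columns C D w \<Longrightarrow> increasing_pair w x y \<longleftrightarrow> linked (set C) (set D) x y"
proof (induction rule: two_columns.induct)
  case empty
  then show ?case by (simp add: increasing_pair_def linked_def)
next
  case (single C D w z)
  note tw = two_columns_basic[OF single.hyps(1)]
  have "z \<notin> set w" "\<not> (\<exists>y\<in>set w. z < y)" using single.hyps(2) tw(2) by (auto dest: less_asym)
  moreover have "set (C @ [z]) = insert z (set C)" by simp
  ultimately show ?case using single.IH single.hyps(2)
    using linked_insert_left[of "set C" z "set D" x y] increasing_pair_Cons[of z w] by auto
next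
  case (pair C D w b z)
  note tw = two_columns_basic[OF pair.hyps(1)]
  have zw: "z \<notin> set w" "\<not> (\<exists>y\<in>set w. z < y)"
    using pair.hyps tw(2) by (auto dest: less_trans less_asym)
  have bw: "b \<notin> set (z # w)" using pair.hyps tw(2) by auto
  have "increasing_pair (b # z # w) x y \<longleftrightarrow>
      x = b \<and> y \<in> set (z # w) \<and> b < y \<or> increasing_pair w x y"
    unfolding increasing_pair_Cons[OF bw] increasing_pair_Cons[OF zw(1)] using zw(2) by blast
  moreover have "y \<in> set (z # w) \<and> b < y \<longleftrightarrow> y \<in> insert z (set D) \<and> b < y"
    using tw(2) pair.hyps(2) by (auto dest: less_asym)
  moreover have "set (C @ [b]) = insert b (set C)" "set (D @ [z]) = insert z (set D)" by auto
  ultimately show ?case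
    using linked_insert_both[of "set C" "set D" b z x y] pair.hyps pair.IH by auto
qed

text \<open>The pairs added by the \<open>pair\<close> steps form the matching. Read as matrix
  positions they give a member of the space with a nonzero minor of size
  \<open>card (set D)\<close>, so the generic rank is the length of the second column.\<close>

lemma two_columns_matching:
  "two_columns C D w \<Longrightarrow> \<exists>M. finite M \<and> (\<forall>(x, y)\<in>M. increasing_pair w x y) \<and>
     inj_on fst M \<and> inj_on snd M \<and> snd ` M = set D"
proof (induction rule: two_columns.induct)
  case empty
  then show ?case by (intro exI[of _ "{}"]) auto
next
  case (single C D w z)
  note tw = two_columns_basic[OF single.hyps(1)]
  have "z \<notin> set w" using single.hyps(2) tw(2) by auto
  then show ?case using single.IH increasing_pair_Cons[of z w] by fastforce
next
  case (pair C D w b z)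
  note tw = two_columns_basic[OF pair.hyps(1)]
  obtain M where M: "finite M" "\<forall>(x, y)\<in>M. increasing_pair w x y"
     "inj_on fst M" "inj_on snd M" "snd ` M = set D" using pair.IH by blast
  have zw: "z \<notin> set w" using pair.hyps tw(2) by (auto dest: less_trans)
  have bw: "b \<notin> set (z # w)" using pair.hyps tw(2) by auto
  have Mw: "fst p \<in> set w" "snd p \<in> set w" if "p \<in> M" for p
    using M(2) that by (cases p; auto simp: increasing_pair_def)+
  have "increasing_pair (b # z # w) b z" using increasing_pair_Cons[OF bw] pair.hyps by auto
  moreover have "increasing_pair (b # z # w) x y" if "increasing_pair w x y" for x y
    using that increasing_pair_Cons[OF bw] increasing_pair_Cons[OF zw] by blast
  ultimately have "\<forall>(x, y)\<in>insert (b, z) M. increasing_pair (b # z # w) x y" using M(2) by auto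
  moreover have "inj_on fst (insert (b, z) M)" "inj_on snd (insert (b, z) M)"
    using M(3,4) Mw zw bw by (auto simp: inj_on_insert)
  ultimately show ?case using M by (intro exI[of _ "insert (b, z) M"]) auto
qed

lemma two_columns_ballot:
  "two_columns C D w \<Longrightarrow> card (set D \<inter> {..t}) \<le> card (set C \<inter> {..t})"
proof (induction rule: two_columns.induct)
  case empty
  then show ?case by simp
next
  case (single C D w z)
  have "card (set C \<inter> {..t}) \<le> card (set (C @ [z]) \<inter> {..t})" by (intro card_mono) auto
  then show ?case using single.IH by simp
next
  case (pair C D w b z)
  have "b \<notin> set C" "z \<notin> set D" using pair.hyps by blast+
  then show ?case using pair.IH pair.hyps(5) card_insert_Int[of "set C" b "{..t}"]
    card_insert_Int[of "set D" z "{..t}"] by auto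
qed

section \<open>Balanced intervals\<close>

definition dyck_interval :: "nat set \<Rightarrow> nat set \<Rightarrow> nat \<Rightarrow> nat \<Rightarrow> bool" where
  "dyck_interval A E p q \<longleftrightarrow> p \<le> q \<and> card (A \<inter> {p..q}) = card (E \<inter> {p..q}) \<and>
     (\<forall>t\<in>{p..q}. card (E \<inter> {p..t}) \<le> card (A \<inter> {p..t}))"

text \<open>The lattice path of the parenthesis word: an opening letter goes up, a closing one goes
  down. Balanced intervals become excursions, which the unit steps make easy to locate.\<close>

definition height :: "nat set \<Rightarrow> nat set \<Rightarrow> nat \<Rightarrow> int" where
  "height A E t = int (card (A \<inter> {1..t})) - int (card (E \<inter> {1..t}))"

lemma card_Int_interval_split:
  assumes "p \<le> t" "t \<le> (q::nat)"
  shows "card (A \<inter> {p..q}) = card (A \<inter> {p..t}) + card (A \<inter> {Suc t..q})"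
proof -
  have "A \<inter> {p..q} = (A \<inter> {p..t}) \<union> (A \<inter> {Suc t..q})" using assms by auto
  then show ?thesis by (simp add: card_Un_disjoint disjoint_iff)
qed

lemma height_Suc:
  "height A E (Suc t) = height A E t + of_bool (Suc t \<in> A) - of_bool (Suc t \<in> E)"
proof -
  have "card (X \<inter> {1..Suc t}) = card (X \<inter> {1..t}) + of_bool (Suc t \<in> X)" for X
  proof -
    have "X \<inter> {1..Suc t} = (if Suc t \<in> X then insert (Suc t) (X \<inter> {1..t}) else X \<inter> {1..t})"
      by (auto simp: le_Suc_eq)
    then show ?thesis by simp
  qed
  then show ?thesis unfolding height_def by simp
qed

lemma height_diff:
  assumes "u \<le> t"
  shows "height A E t - height A E u = int (card (A \<inter> {Suc u..t})) - int (card (E \<inter> {Suc u..t}))"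
proof (cases "u = 0")
  case True
  then show ?thesis by (simp add: height_def)
next
  case False
  then show ?thesis unfolding height_def
    using card_Int_interval_split[of 1 u t A] card_Int_interval_split[of 1 u t E] assms by simp
qed

lemma dyck_interval_iff_height:
  "dyck_interval A E (Suc u) q \<longleftrightarrow>
    u < q \<and> height A E q = height A E u \<and> (\<forall>t. u < t \<and> t \<le> q \<longrightarrow> height A E u \<le> height A E t)"
proof -
  have "card (A \<inter> {Suc u..t}) = card (E \<inter> {Suc u..t}) \<longleftrightarrow> height A E t = height A E u"
    "card (E \<inter> {Suc u..t}) \<le> card (A \<inter> {Suc u..t}) \<longleftrightarrow> height A E u \<le> height A E t"
    if "u < t" for t
    using height_diff[of u t A E] that by linarith+
  then show ?thesis unfolding dyck_interval_def by (auto simp: Suc_le_eq)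
qed

text \<open>The interval starts after the last place \<open>u\<close> before \<open>z\<close> whose
  height is at most that of \<open>z\<close>. Beyond \<open>u\<close> the path stays strictly
  higher, and unit steps force equality at \<open>u\<close>.\<close>

lemma dyck_interval_ending_at:
  assumes z: "z \<in> E" "z \<notin> A" and v: "v < z" "height A E v \<le> height A E z"
  obtains p where "v < p" "p < z" "dyck_interval A E p z"
proof -
  let ?H = "height A E"
  let ?P = "\<lambda>u. u < z \<and> ?H u \<le> ?H z"
  define u where "u = Greatest ?P"
  have u: "?P u" "v \<le> u"
    unfolding u_def using GreatestI_nat[of ?P v z] Greatest_le_nat[of ?P v z] v by auto
  have above: "?H z < ?H t" if "u < t" "t < z" for t
    using Greatest_le_nat[of ?P t z] that unfolding u_def[symmetric] by force
  obtain z' where z': "z = Suc z'" using v by (cases z) auto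
  \<comment> \<open>A closing letter comes down to its height, so the place just before
    \<open>z\<close> is too high to be \<open>u\<close>.\<close>
  have "?H z = ?H z' - 1" using z by (simp add: z' height_Suc)
  then have "u \<noteq> z'" using u by auto
  then have uz: "Suc u < z" using u z' by auto
  have "?H z < ?H (Suc u)" using above uz by blast
  then have "?H u = ?H z" using u height_Suc[of A E u] by (auto simp: of_bool_def split: if_splits)
  then have "dyck_interval A E (Suc u) z"
    unfolding dyck_interval_iff_height using u above by (metis le_less order_refl)
  then show thesis using that[of "Suc u"] u uz by simp
qed

text \<open>Mirror image with the first return: \<open>q\<close> is the first place after
  \<open>u\<close> where the path is no higher than at \<open>u\<close>, and unit steps make the
  heights equal.\<close>

lemma dyck_interval_starting_at:
  assumes z: "Suc u \<in> A" "Suc u \<notin> E" and v: "u < v" "height A E v \<le> height A E u"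
  obtains q where "Suc u < q" "q \<le> v" "dyck_interval A E (Suc u) q"
proof -
  let ?H = "height A E"
  let ?P = "\<lambda>t. u < t \<and> ?H t \<le> ?H u"
  define q where "q = Least ?P"
  have q: "?P q" "q \<le> v" unfolding q_def using LeastI[of ?P v] Least_le[of ?P v] v by auto
  have above: "?H u < ?H t" if "u < t" "t < q" for t
    using not_less_Least[of t ?P] that unfolding q_def[symmetric] by force
  have "?H (Suc u) = ?H u + 1" using z by (simp add: height_Suc)
  then have "q \<noteq> Suc u" using q by auto
  then obtain q' where q': "q = Suc q'" "u < q'" using q by (cases q) auto
  have "?H u < ?H q'" using above q' by simp
  then have "?H q = ?H u" using q height_Suc[of A E q'] unfolding q' by (auto simp: of_bool_def split: if_splits)
  then have "dyck_interval A E (Suc u) q"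
    unfolding dyck_interval_iff_height using q above by (metis le_less order_refl)
  then show thesis using that[of q] q \<open>q \<noteq> Suc u\<close> by simp
qed

lemma strict_mono_bij_card_tails:
  fixes h :: "nat \<Rightarrow> nat"
  assumes h: "bij_betw h {..<r} X" "strict_mono_on {..<r} h" and i: "i < r"
  shows "card (X \<inter> {h i..}) = r - i" "card (X \<inter> {..h i}) = Suc i" "card (X \<inter> {..<h i}) = i"
proof -
  have inj: "inj_on h {..<r}" and X: "X = h ` {..<r}" using h(1) unfolding bij_betw_def by auto
  have le: "h j \<le> h k \<longleftrightarrow> j \<le> k" if "j < r" "k < r" for j k
    using strict_mono_on_less_eq[OF h(2)] that by simp
  have lt: "h j < h k \<longleftrightarrow> j < k" if "j < r" "k < r" for j k
    using strict_mono_on_less[OF h(2)] that by simp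
  have "X \<inter> {h i..} = h ` {i..<r}" "X \<inter> {..h i} = h ` {..i}" "X \<inter> {..<h i} = h ` {..<i}"
    unfolding X using i by (auto simp: le lt)
  moreover have "inj_on h {i..<r}" "inj_on h {..i}" "inj_on h {..<i}"
    using i by (auto intro: inj_on_subset[OF inj])
  ultimately show "card (X \<inter> {h i..}) = r - i" "card (X \<inter> {..h i}) = Suc i" "card (X \<inter> {..<h i}) = i"
    by (simp_all add: card_image)
qed

text \<open>Openings and closings are paired in increasing order, not by nesting: for openings 1, 2
  and closings 3, 4 the nested pair (1, 4) is not linked. With the window ending at
  \<open>e\<close>, the letters from the \<open>i\<close>-th opening on and from the
  \<open>i\<close>-th closing on both number \<open>r - i\<close>.\<close>

lemma dyck_interval_linked_pairs:
  assumes d: "dyck_interval A E z e" and disj: "A \<inter> E = {}"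
  defines "r \<equiv> card (A \<inter> {z..e})"
  obtains h k where "bij_betw h {..<r} (A \<inter> {z..e})" "bij_betw k {..<r} (E \<inter> {z..e})"
    "\<And>i. i < r \<Longrightarrow> linked A E (h i) (k i)"
proof -
  obtain h where h: "bij_betw h {..<r} (A \<inter> {z..e})" "strict_mono_on {..<r} h"
    using ex_bij_betw_strict_mono_card[of "A \<inter> {z..e}"] unfolding r_def by auto
  have r: "r = card (E \<inter> {z..e})" using d unfolding r_def dyck_interval_def by simp
  obtain k where k: "bij_betw k {..<r} (E \<inter> {z..e})" "strict_mono_on {..<r} k"
    using ex_bij_betw_strict_mono_card[of "E \<inter> {z..e}"] unfolding r by auto
  have "linked A E (h i) (k i)" if i: "i < r" for i
  proof -
    have hi: "h i \<in> A" "h i \<in> {z..e}" and ki: "k i \<in> E" "k i \<in> {z..e}"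
      using bij_betwE[OF h(1)] bij_betwE[OF k(1)] i by auto
    note ch = strict_mono_bij_card_tails[OF h i] and ck = strict_mono_bij_card_tails[OF k i]
    \<comment> \<open>Otherwise the prefix up to \<open>k i\<close> would contain
      \<open>i + 1\<close> closings but at most \<open>i\<close> openings.\<close>
    have "\<not> k i < h i"
    proof
      assume lt: "k i < h i"
      have "card (A \<inter> {z..k i}) \<le> card (A \<inter> {z..e} \<inter> {..<h i})"
        using lt ki by (intro card_mono) auto
      moreover have "E \<inter> {z..e} \<inter> {..k i} = E \<inter> {z..k i}" using ki by auto
      then have "card (E \<inter> {z..k i}) = Suc i" using ck(2) by simp
      moreover have "card (E \<inter> {z..k i}) \<le> card (A \<inter> {z..k i})"
        using d ki(2) unfolding dyck_interval_def by blast
      ultimately show False using ch(3) by simp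
    qed
    then have "h i < k i" using hi ki disj by (metis IntI empty_iff not_less_iff_gr_or_eq)
    moreover have "A \<inter> {h i..e} = A \<inter> {z..e} \<inter> {h i..}" "E \<inter> {k i..e} = E \<inter> {z..e} \<inter> {k i..}"
      using hi ki by auto
    then have "card (A \<inter> {h i..e}) \<le> card (E \<inter> {k i..e})" using ch(1) ck(1) by simp
    ultimately show ?thesis unfolding linked_def using hi ki by auto
  qed
  then show thesis using that h(1) k(1) by blast
qed

text \<open>The least admissible window end \<open>m\<close> is a closing letter, for otherwise the
  window could be shortened, and the ballot condition supplies an excursion ending there. If that
  excursion began after \<open>x\<close>, either the openings would outnumber the closings in the
  window, or removing the excursion would leave a shorter admissible window.\<close>

lemma linked_imp_dyck_interval:
  assumes fin: "finite A" "finite E" and disj: "A \<inter> E = {}" and pos: "0 \<notin> A" "0 \<notin> E"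
    and ballot: "\<And>t. card (E \<inter> {..t}) \<le> card (A \<inter> {..t})"
    and l: "linked A E x y"
  obtains p m where "1 \<le> p" "p \<le> x" "y \<le> m" "m \<in> E" "dyck_interval A E p m"
    "card (A \<inter> {x..m}) \<le> card (E \<inter> {y..m})"
proof -
  let ?P = "\<lambda>m. m \<ge> y \<and> card (A \<inter> {x..m}) \<le> card (E \<inter> {y..m})"
  have xy: "x \<in> A" "y \<in> E" "x < y" and ex: "\<exists>m. ?P m" using l unfolding linked_def by auto
  define m where "m = Least ?P"
  have m: "?P m" unfolding m_def using ex by (rule LeastI_ex)
  have mmin: "\<not> ?P t" if "t < m" for t using not_less_Least that unfolding m_def by blast
  have "m \<in> E"
  proof (rule ccontr)
    assume mE: "m \<notin> E"
    then have "y < m" using m xy by (cases "y = m") auto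
    then obtain k where k: "m = Suc k" "y \<le> k" by (cases m) auto
    have "E \<inter> {y..m} = E \<inter> {y..k}" using mE k by (auto simp: le_Suc_eq)
    moreover have "card (A \<inter> {x..k}) \<le> card (A \<inter> {x..m})"
      using fin k by (intro card_mono) auto
    ultimately have "?P k" using m k by auto
    then show False using mmin[of k] k by simp
  qed
  have "X \<inter> {..t} = X \<inter> {1..t}" if "0 \<notin> X" for X :: "nat set" and t
    using that by (auto simp: Suc_le_eq intro: gr0I)
  then have "height A E m \<ge> 0" unfolding height_def using ballot[of m] pos by simp
  then have "height A E 0 \<le> height A E m" by (simp add: height_def)
  moreover have "m \<notin> A" "0 < m" using \<open>m \<in> E\<close> disj xy m by auto
  ultimately obtain p where p: "0 < p" "p < m" "dyck_interval A E p m"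
    using dyck_interval_ending_at[of m E A 0] \<open>m \<in> E\<close> by blast
  have bal: "card (A \<inter> {p..m}) = card (E \<inter> {p..m})" using p(3) unfolding dyck_interval_def by simp
  have "p \<le> x"
  proof (rule ccontr)
    assume "\<not> p \<le> x"
    then obtain k where k: "p = Suc k" "x \<le> k" by (cases p) auto
    have A: "card (A \<inter> {x..m}) = card (A \<inter> {x..k}) + card (A \<inter> {p..m})"
      using card_Int_interval_split[of x k m A] k p by simp
    show False
    proof (cases "p \<le> y")
      case True
      have "card (E \<inter> {y..m}) \<le> card (E \<inter> {p..m})" using True fin by (intro card_mono) auto
      moreover have "card (A \<inter> {x..k}) > 0" using xy k fin by (auto simp: card_gt_0_iff)
      ultimately show False using m A bal by simp
    next
      case False
      then have "card (E \<inter> {y..m}) = card (E \<inter> {y..k}) + card (E \<inter> {p..m})"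
        using card_Int_interval_split[of y k m E] k p by simp
      then have "?P k" using m A bal False k by simp
      then show False using mmin[of k] k p by simp
    qed
  qed
  then show thesis using that[of p m] p m \<open>m \<in> E\<close> by auto
qed

text \<open>The assumption \<open>cut\<close> is what the rank comparison provides.  On a balanced interval \<open>{z..e}\<close> of
  \<open>(A, E)\<close> the extreme cuts force both \<open>A'\<close> and \<open>E'\<close> to fill half of it, and the cuts next to the ends then
  force \<open>z \<in> A'\<close> and \<open>e \<in> E'\<close>.\<close>

lemma linked_transfer:
  assumes S: "finite A" "finite E" "A \<inter> E = {}" "A \<union> E = {1..n}"
      "\<And>t. card (E \<inter> {..t}) \<le> card (A \<inter> {..t})"
    and T: "A' \<inter> E' = {}" "A' \<union> E' = {1..n}"
    and cut: "\<And>z e c. dyck_interval A E z e \<Longrightarrow> 1 \<le> z \<Longrightarrow> e \<le> n \<Longrightarrow> z \<le> c \<Longrightarrow> c \<le> Suc e \<Longrightarrow>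
      card (A \<inter> {z..e}) \<le> card (A' \<inter> {z..<c}) + card (E' \<inter> {c..e})"
    and l: "linked A E x y"
  shows "linked A' E' x y"
proof -
  have pos: "0 \<notin> A" "0 \<notin> E" using S(4) by (metis UnCI atLeastAtMost_iff not_one_le_zero)+
  have ends: "z \<in> A' \<and> e \<in> E'" if d: "dyck_interval A E z e" "1 \<le> z" "e \<le> n" for z e
  proof -
    let ?r = "card (A \<inter> {z..e})"
    have ze: "z \<le> e" and r: "card (E \<inter> {z..e}) = ?r" using d unfolding dyck_interval_def by auto
    have sum: "card (X \<inter> {z..e}) + card (Y \<inter> {z..e}) = card {z..e}"
      if "X \<inter> Y = {}" "X \<union> Y = {1..n}" for X Y
    proof -
      have "(X \<inter> {z..e}) \<union> (Y \<inter> {z..e}) = {z..e}" using that(2) d ze by auto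
      moreover have "(X \<inter> {z..e}) \<inter> (Y \<inter> {z..e}) = {}" using that(1) by blast
      ultimately show ?thesis by (metis card_Un_disjoint finite_Int finite_atLeastAtMost)
    qed
    have e1: "?r \<le> card (E' \<inter> {z..e})" using cut[OF d, of z] ze by simp
    have "?r \<le> card (A' \<inter> {z..e})" using cut[OF d, of "Suc e"] ze by (simp add: atLeastLessThanSuc_atLeastAtMost)
    then have eq: "card (A' \<inter> {z..e}) = ?r" "card (E' \<inter> {z..e}) = ?r"
      using e1 sum[OF S(3,4)] sum[OF T] r by linarith+
    have "z \<in> A'"
    proof (rule ccontr)
      assume z: "z \<notin> A'"
      then have "z \<in> E'" using T d ze by auto
      then have "E' \<inter> {z..e} = insert z (E' \<inter> {Suc z..e})" using ze by auto
      then have "card (E' \<inter> {z..e}) = Suc (card (E' \<inter> {Suc z..e}))" by simp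
      moreover have "A' \<inter> {z..<Suc z} = {}" using z by auto
      then have "?r \<le> card (E' \<inter> {Suc z..e})" using cut[OF d, of "Suc z"] ze by simp
      ultimately show False using eq by simp
    qed
    moreover have "e \<in> E'"
    proof (rule ccontr)
      assume e: "e \<notin> E'"
      then have "e \<in> A'" using T d ze by auto
      then have "A' \<inter> {z..e} = insert e (A' \<inter> {z..<e})" using ze by auto
      then have "card (A' \<inter> {z..e}) = Suc (card (A' \<inter> {z..<e}))" by simp
      moreover have "E' \<inter> {e..e} = {}" using e by auto
      then have "?r \<le> card (A' \<inter> {z..<e})" using cut[OF d, of e] ze by simp
      ultimately show False using eq by simp
    qed
    ultimately show ?thesis by blast
  qed
  obtain p m where pm: "1 \<le> p" "p \<le> x" "y \<le> m" "m \<in> E" "dyck_interval A E p m"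
    and le: "card (A \<inter> {x..m}) \<le> card (E \<inter> {y..m})"
    using linked_imp_dyck_interval[OF S(1-3) pos S(5) l] by metis
  obtain u where u: "p = Suc u" using pm by (cases p) auto
  let ?H = "height A E"
  have H: "u < m" "?H m = ?H u" "\<And>t. u \<le> t \<Longrightarrow> t \<le> m \<Longrightarrow> ?H u \<le> ?H t"
    using pm(5) unfolding u dyck_interval_iff_height by (auto simp: le_less)
  have mE: "m \<le> n" using pm(4) S(4) by auto
  \<comment> \<open>At the end of the interval the path is back at height \<open>?H u\<close>, which
    is at most the height just before \<open>z\<close>. So every opening begins a balanced
    subinterval of its own, to which \<open>ends\<close> applies; closings are treated from the
    other side.\<close>
  have A: "z \<in> A'" if z: "z \<in> A" "p \<le> z" "z \<le> m" for z
  proof -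
    obtain t where t: "z = Suc t" "u \<le> t" using z u by (cases z) auto
    have "?H m \<le> ?H t" using H t z by simp
    then obtain q where "q \<le> m" "dyck_interval A E z q"
      using dyck_interval_starting_at[of t A E m] z t S(3) by (metis IntI Suc_le_lessD empty_iff)
    then show ?thesis using ends[of z q] t mE by simp
  qed
  have E: "z \<in> E'" if z: "z \<in> E" "p \<le> z" "z \<le> m" for z
  proof -
    have "u < z" "?H u \<le> ?H z" using H z u by auto
    then obtain q where "u < q" "dyck_interval A E q z"
      using dyck_interval_ending_at[of z E A u] z S(3) by (metis IntI empty_iff)
    then show ?thesis using ends[of q z] z mE by simp
  qed
  \<comment> \<open>Both pairs of sets partition the same letters, so containment for openings and
    for closings already gives agreement.\<close>
  have "z \<in> A' \<longleftrightarrow> z \<in> A" "z \<in> E' \<longleftrightarrow> z \<in> E" if "p \<le> z" "z \<le> m" for z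
    using A[of z] E[of z] that S(3,4) T pm(1) mE by auto
  then have "A' \<inter> {x..m} = A \<inter> {x..m}" "E' \<inter> {y..m} = E \<inter> {y..m}"
    "x \<in> A'" "y \<in> E'"
    using pm l unfolding linked_def by auto
  then show ?thesis using l le pm(3) unfolding linked_def by auto
qed

section \<open>Zariski closure and conjugation\<close>

lemma index_mult_mat_sum:
  assumes "A \<in> carrier_mat n m" "B \<in> carrier_mat m l" "i < n" "j < l"
  shows "(A * B) $$ (i, j) = (\<Sum>k<m. A $$ (i, k) * B $$ (k, j))"
  using assms by (auto simp: scalar_prod_def lessThan_atLeast0 intro!: sum.cong)

lemma index_mult3_mat_sum:
  assumes "g \<in> carrier_mat n n" "A \<in> carrier_mat n n" "h \<in> carrier_mat n n" "i < n" "j < n"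
  shows "(g * A * h) $$ (i, j) = (\<Sum>t<n. \<Sum>s<n. g $$ (i, s) * A $$ (s, t) * h $$ (t, j))"
proof -
  have gA: "g * A \<in> carrier_mat n n" using assms by auto
  show ?thesis
    using index_mult_mat_sum[OF gA assms(3-5)] index_mult_mat_sum[OF assms(1,2,4)]
    by (simp add: sum_distrib_right)
qed

section \<open>Polynomial functions and minors\<close>

lemma polynomial_functions_sum:
  "(\<And>i. i \<in> I \<Longrightarrow> f i \<in> polynomial_functions n) \<Longrightarrow> (\<lambda>X. \<Sum>i\<in>I. f i X) \<in> polynomial_functions n"
  by (induction I rule: infinite_finite_induct) (auto intro: polynomial_functions.intros)

lemma polynomial_functions_prod:
  "(\<And>i. i \<in> I \<Longrightarrow> f i \<in> polynomial_functions n) \<Longrightarrow> (\<lambda>X. \<Prod>i\<in>I. f i X) \<in> polynomial_functions n"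
  by (induction I rule: infinite_finite_induct) (auto intro: polynomial_functions.intros)

definition minor :: "nat \<Rightarrow> (nat \<Rightarrow> nat) \<Rightarrow> (nat \<Rightarrow> nat) \<Rightarrow> complex mat \<Rightarrow> complex" where
  "minor r h k X = det (mat r r (\<lambda>(i, j). X $$ (h i, k j)))"

lemma minor_polynomial:
  assumes "\<And>i. i < r \<Longrightarrow> h i < n \<and> k i < n"
  shows "minor r h k \<in> polynomial_functions n"
proof -
  have "minor r h k = (\<lambda>X. \<Sum>p | p permutes {0..<r}. signof p * (\<Prod>i = 0..<r. X $$ (h i, k (p i))))"
    unfolding minor_def by (auto simp: det_def fun_eq_iff intro!: sum.cong prod.cong)
  also have "\<dots> \<in> polynomial_functions n"
    using assms
    by (intro polynomial_functions_sum polynomial_functions.intros polynomial_functions_prod)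
      (auto dest: permutes_in_image)
  finally show ?thesis .
qed

lemma polynomial_functions_conj:
  assumes "f \<in> polynomial_functions n" and gh: "g \<in> carrier_mat n n" "h \<in> carrier_mat n n"
  obtains f' where "f' \<in> polynomial_functions n" "\<And>X. X \<in> carrier_mat n n \<Longrightarrow> f' X = f (g * X * h)"
proof -
  have "\<exists>f'\<in>polynomial_functions n. \<forall>X\<in>carrier_mat n n. f' X = f (g * X * h)"
    using assms(1)
  proof (induction rule: polynomial_functions.induct)
    case (const c)
    then show ?case by (intro bexI[OF _ polynomial_functions.const]) auto
  next
    case (entry i j)
    have "(\<lambda>X. \<Sum>t<n. \<Sum>s<n. g $$ (i, s) * X $$ (s, t) * h $$ (t, j)) \<in> polynomial_functions n"
      by (intro polynomial_functions_sum polynomial_functions.intros) auto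
    then show ?case using index_mult3_mat_sum[OF gh(1) _ gh(2) entry] by force
  next
    case (add f1 f2)
    then obtain f1' f2' where "f1' \<in> polynomial_functions n" "f2' \<in> polynomial_functions n"
      "\<forall>X\<in>carrier_mat n n. f1' X = f1 (g * X * h)" "\<forall>X\<in>carrier_mat n n. f2' X = f2 (g * X * h)"
      by blast
    then show ?case by (intro bexI[OF _ polynomial_functions.add[of f1' n f2']]) auto
  next
    case (mult f1 f2)
    then obtain f1' f2' where "f1' \<in> polynomial_functions n" "f2' \<in> polynomial_functions n"
      "\<forall>X\<in>carrier_mat n n. f1' X = f1 (g * X * h)" "\<forall>X\<in>carrier_mat n n. f2' X = f2 (g * X * h)"
      by blast
    then show ?case by (intro bexI[OF _ polynomial_functions.mult[of f1' n f2']]) auto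
  qed
  then show thesis using that by blast
qed

lemma polynomial_functions_line:
  assumes "f \<in> polynomial_functions n" "X \<in> carrier_mat n n" "Y \<in> carrier_mat n n"
  obtains p where "\<And>t. f (X + t \<cdot>\<^sub>m Y) = poly p t"
proof -
  have "\<exists>p. \<forall>t. f (X + t \<cdot>\<^sub>m Y) = poly p t"
    using assms(1)
  proof (induction rule: polynomial_functions.induct)
    case (const c)
    then show ?case by (intro exI[of _ "[:c:]"]) simp
  next
    case (entry i j)
    then show ?case using assms(2,3) by (intro exI[of _ "[:X $$ (i, j), Y $$ (i, j):]"]) auto
  next
    case (add f g)
    then obtain p q where "\<forall>t. f (X + t \<cdot>\<^sub>m Y) = poly p t" "\<forall>t. g (X + t \<cdot>\<^sub>m Y) = poly q t" by blast
    then show ?case by (intro exI[of _ "p + q"]) simp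
  next
    case (mult f g)
    then obtain p q where "\<forall>t. f (X + t \<cdot>\<^sub>m Y) = poly p t" "\<forall>t. g (X + t \<cdot>\<^sub>m Y) = poly q t" by blast
    then show ?case by (intro exI[of _ "p * q"]) simp
  qed
  then show thesis using that by blast
qed

text \<open>This stands in for the irreducibility of a linear space. On the line from
  \<open>X\<close> to \<open>Y\<close> the functions \<open>f\<close> and \<open>q\<close> become
  univariate polynomials with zero product. The one from \<open>q\<close> is nonzero at parameter 1,
  so the one from \<open>f\<close> is zero, in particular at parameter 0.\<close>

lemma polynomial_vanishes_if_generically:
  assumes L: "L \<subseteq> carrier_mat n n" "\<And>X Y t. X \<in> L \<Longrightarrow> Y \<in> L \<Longrightarrow> X + t \<cdot>\<^sub>m (Y - X) \<in> L"
    and f: "f \<in> polynomial_functions n" and q: "q \<in> polynomial_functions n"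
    and Y: "Y \<in> L" "q Y \<noteq> 0"
    and gen: "\<And>Z. Z \<in> L \<Longrightarrow> q Z \<noteq> 0 \<Longrightarrow> f Z = 0"
    and X: "X \<in> L"
  shows "f X = 0"
proof -
  have "X \<in> carrier_mat n n" using L X by blast
  then have c: "X \<in> carrier_mat n n" "Y - X \<in> carrier_mat n n" by auto
  have XY: "X + 1 \<cdot>\<^sub>m (Y - X) = Y" "X + 0 \<cdot>\<^sub>m (Y - X) = X"
    using c(1) subsetD[OF L(1) Y(1)] by (auto intro!: eq_matI)
  obtain p where p: "\<And>t. f (X + t \<cdot>\<^sub>m (Y - X)) = poly p t"
    using polynomial_functions_line[OF f c] by blast
  obtain r where r: "\<And>t. q (X + t \<cdot>\<^sub>m (Y - X)) = poly r t"
    using polynomial_functions_line[OF q c] by blast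
  have "poly (p * r) t = 0" for t
    using gen[OF L(2)[OF X Y(1)], of t] p[of t] r[of t] by auto
  then have "p * r = 0" using poly_all_0_iff_0 by blast
  moreover have "r \<noteq> 0" using r[of 1] XY(1) Y(2) by auto
  ultimately have "p = 0" by simp
  then show ?thesis using p[of 0] XY(2) by simp
qed

lemma zariski_closureI:
  assumes "S \<subseteq> carrier_mat n n" "X \<in> carrier_mat n n"
    "\<And>f. f \<in> polynomial_functions n \<Longrightarrow> (\<And>Y. Y \<in> S \<Longrightarrow> f Y = 0) \<Longrightarrow> f X = 0"
  shows "X \<in> zariski_closure n S"
  using assms by (simp add: zariski_closure_iff)

lemma zariski_closureD:
  assumes "X \<in> zariski_closure n S" "S \<subseteq> carrier_mat n n" "f \<in> polynomial_functions n"
    "\<And>Y. Y \<in> S \<Longrightarrow> f Y = 0"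
  shows "f X = 0"
  using assms by (simp add: zariski_closure_iff)

lemma zariski_closure_subset: "S \<subseteq> zariski_closure n S"
  unfolding zariski_closure_def by (rule hull_subset)

lemma zariski_closure_carrier:
  "S \<subseteq> carrier_mat n n \<Longrightarrow> zariski_closure n S \<subseteq> carrier_mat n n"
  by (auto simp: zariski_closure_iff)

lemma zariski_closure_least:
  assumes "S \<subseteq> zariski_closure n S'"
  shows "zariski_closure n S \<subseteq> zariski_closure n S'"
  using assms hull_mono[of S "zariski_closure n S'" "zariski_closed n"]
  unfolding zariski_closure_def by (simp add: hull_hull)

section \<open>Saturation under a group of matrices\<close>

lemma conjugatesI:
  assumes "g \<in> H" "g \<in> carrier_mat n n" "h \<in> carrier_mat n n" "g * h = 1\<^sub>m n" "h * g = 1\<^sub>m n" "X \<in> S"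
  shows "g * X * h \<in> conjugates n H S"
  using assms unfolding conjugates_def inverts_mat_def by auto

lemma conjugatesE:
  assumes "Y \<in> conjugates n H S" "H \<subseteq> carrier_mat n n"
  obtains g h X where "g \<in> H" "g \<in> carrier_mat n n" "h \<in> carrier_mat n n"
    "g * h = 1\<^sub>m n" "h * g = 1\<^sub>m n" "X \<in> S" "Y = g * X * h"
proof -
  obtain g h X where *: "g \<in> H" "h \<in> carrier_mat n n" "inverts_mat g h" "inverts_mat h g"
    "X \<in> S" "Y = g * X * h" using assms(1) unfolding conjugates_def by blast
  then have "g \<in> carrier_mat n n" using assms(2) by blast
  then show thesis using that[of g h X] * by (auto simp: inverts_mat_def)
qed

lemma conjugates_mono: "H \<subseteq> H' \<Longrightarrow> S \<subseteq> S' \<Longrightarrow> conjugates n H S \<subseteq> conjugates n H' S'"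
  unfolding conjugates_def by blast

lemma conjugates_carrier:
  assumes "H \<subseteq> carrier_mat n n" "S \<subseteq> carrier_mat n n"
  shows "conjugates n H S \<subseteq> carrier_mat n n"
proof
  fix Y assume "Y \<in> conjugates n H S"
  then show "Y \<in> carrier_mat n n"
    by (rule conjugatesE[OF _ assms(1)]) (use assms(2) in auto)
qed

lemma conj_mult_assoc:
  assumes "g \<in> carrier_mat n n" "h \<in> carrier_mat n n" "g' \<in> carrier_mat n n" "h' \<in> carrier_mat n n"
    "X \<in> carrier_mat n n"
  shows "g * (g' * X * h') * h = (g * g') * X * (h' * (h :: complex mat))"
proof -
  note [simp] = assoc_mult_mat[of _ n n _ n _ n]
  show ?thesis using assms by simp
qed

lemma inverse_mult_mat:
  assumes "g \<in> carrier_mat n n" "h \<in> carrier_mat n n" "g' \<in> carrier_mat n n" "h' \<in> carrier_mat n n"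
    "g * h = 1\<^sub>m n" "g' * h' = 1\<^sub>m n"
  shows "(g * g') * (h' * h) = (1\<^sub>m n :: complex mat)"
proof -
  have "(g * g') * (h' * h) = g * ((g' * h') * h)"
    using assms(1-4) by (simp add: assoc_mult_mat[of _ n n _ n _ n])
  then show ?thesis using assms by simp
qed

lemma conjugates_conjugates:
  assumes H: "H \<subseteq> carrier_mat n n" "\<And>g g'. g \<in> H \<Longrightarrow> g' \<in> H \<Longrightarrow> g * g' \<in> H"
    and S: "S \<subseteq> carrier_mat n n"
    and g: "g \<in> H" "h \<in> carrier_mat n n" "g * h = 1\<^sub>m n" "h * g = 1\<^sub>m n"
    and Y: "Y \<in> conjugates n H S"
  shows "g * Y * h \<in> conjugates n H S"
proof -
  obtain g' h' X where *: "g' \<in> H" "g' \<in> carrier_mat n n" "h' \<in> carrier_mat n n"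
    "g' * h' = 1\<^sub>m n" "h' * g' = 1\<^sub>m n" "X \<in> S" "Y = g' * X * h'"
    using conjugatesE[OF Y H(1)] by metis
  have gc: "g \<in> carrier_mat n n" using g H by blast
  have "g * Y * h = (g * g') * X * (h' * h)"
    unfolding *(7) using conj_mult_assoc[of g n h g' h' X] gc g * S by blast
  also have "\<dots> \<in> conjugates n H S"
    by (rule conjugatesI)
      (use gc g * H(2) inverse_mult_mat[of g n h g' h'] inverse_mult_mat[of h' n g' h g] in auto)
  finally show ?thesis .
qed

text \<open>For fixed \<open>g\<close>, conjugation is polynomial and maps the saturation of
  \<open>S\<close> into itself, so a polynomial vanishing there can be pulled back along it.\<close>

lemma conjugates_subset_closure:
  assumes H: "H \<subseteq> carrier_mat n n" "\<And>g g'. g \<in> H \<Longrightarrow> g' \<in> H \<Longrightarrow> g * g' \<in> H"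
    and S: "S \<subseteq> carrier_mat n n" "S' \<subseteq> carrier_mat n n"
    and sub: "S' \<subseteq> zariski_closure n (conjugates n H S)"
  shows "conjugates n H S' \<subseteq> zariski_closure n (conjugates n H S)"
proof
  fix Y assume "Y \<in> conjugates n H S'"
  then obtain g h X where *: "g \<in> H" "g \<in> carrier_mat n n" "h \<in> carrier_mat n n"
    "g * h = 1\<^sub>m n" "h * g = 1\<^sub>m n" "X \<in> S'" "Y = g * X * h"
    using conjugatesE[OF _ H(1)] by metis
  note cc = conjugates_carrier[OF H(1) S(1)]
  show "Y \<in> zariski_closure n (conjugates n H S)"
  proof (rule zariski_closureI[OF cc])
    show "Y \<in> carrier_mat n n" using * S by auto
    fix f assume f: "f \<in> polynomial_functions n" "\<And>Y. Y \<in> conjugates n H S \<Longrightarrow> f Y = 0"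
    obtain f' where f': "f' \<in> polynomial_functions n" "\<And>X. X \<in> carrier_mat n n \<Longrightarrow> f' X = f (g * X * h)"
      using polynomial_functions_conj[OF f(1) *(2,3)] by blast
    have "f' Z = 0" if "Z \<in> conjugates n H S" for Z
      using f'(2)[of Z] f(2)[OF conjugates_conjugates[OF H S(1) *(1,3-5) that]] that cc by auto
    then have "f' X = 0" using zariski_closureD[OF _ cc f'(1)] sub * by blast
    then show "f Y = 0" using f'(2)[of X] * S by auto
  qed
qed

lemma SL_carrier: "SL n \<subseteq> carrier_mat n n"
  by (auto simp: SL_def)

lemma SL_mult: "g \<in> SL n \<Longrightarrow> g' \<in> SL n \<Longrightarrow> g * g' \<in> SL n"
  by (auto simp: SL_def det_mult)

lemma Borel_subset_SL: "Borel n \<subseteq> SL n"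
  by (auto simp: Borel_def)

lemma Borel_carrier: "Borel n \<subseteq> carrier_mat n n"
  using Borel_subset_SL SL_carrier by blast

lemma Borel_mult:
  assumes "g \<in> Borel n" "g' \<in> Borel n"
  shows "g * g' \<in> Borel n"
proof -
  have c: "g \<in> carrier_mat n n" "g' \<in> carrier_mat n n" using assms Borel_carrier by blast+
  have u: "upper_triangular g" "upper_triangular g'" using assms by (auto simp: Borel_def)
  have "upper_triangular (g * g')"
  proof (rule upper_triangularI)
    fix i j assume ij: "j < i" "i < dim_row (g * g')"
    then have i: "i < n" "j < n" using c by auto
    have "(g * g') $$ (i, j) = (\<Sum>k<n. g $$ (i, k) * g' $$ (k, j))"
      by (rule index_mult_mat_sum[OF c i])
    also have "\<dots> = 0"
    proof (rule sum.neutral, rule ballI)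
      fix k assume k: "k \<in> {..<n}"
      show "g $$ (i, k) * g' $$ (k, j) = 0"
        using upper_triangularD[OF u(1), of k i] upper_triangularD[OF u(2), of j k] ij k c i
        by (cases "k < i") auto
    qed
    finally show "(g * g') $$ (i, j) = 0" .
  qed
  then show ?thesis using assms SL_mult Borel_subset_SL by (auto simp: Borel_def)
qed

text \<open>Back substitution from the last row upwards; the diagonal of \<open>g\<close> has no
  zero because its determinant is 1.\<close>

lemma Borel_inverse_upper_triangular:
  assumes g: "g \<in> Borel n" and h: "h \<in> carrier_mat n n" "g * h = 1\<^sub>m n"
  shows "upper_triangular h"
proof -
  have c: "g \<in> carrier_mat n n" using g Borel_carrier by blast
  have u: "upper_triangular g" and d: "det g = 1" using g by (auto simp: Borel_def SL_def)
  have "\<not> 0 \<in> set (diag_mat g)" using upper_triangular_imp_det_eq_0_iff[OF c u] d by simp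
  then have diag: "g $$ (i, i) \<noteq> 0" if "i < n" for i using that c by (auto simp: diag_mat_def)
  have "h $$ (t, j) = 0" if "t < n" "j < t" for t j
    using that
  proof (induction "n - t" arbitrary: t rule: less_induct)
    case less
    have "(g * h) $$ (t, j) = (\<Sum>s<n. g $$ (t, s) * h $$ (s, j))"
      using index_mult_mat_sum[OF c h(1)] less.prems by auto
    also have "\<dots> = (\<Sum>s\<in>{t}. g $$ (t, s) * h $$ (s, j))"
    proof (rule sum.mono_neutral_right)
      show "\<forall>s\<in>{..<n} - {t}. g $$ (t, s) * h $$ (s, j) = 0"
      proof
        fix s assume s: "s \<in> {..<n} - {t}"
        show "g $$ (t, s) * h $$ (s, j) = 0"
        proof (cases "s < t")
          case True
          then show ?thesis using upper_triangularD[OF u, of s t] less.prems c by auto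
        next
          case False
          then have "t < s" "s < n" using s by auto
          then have "n - s < n - t" by simp
          then have "h $$ (s, j) = 0" using less.hyps[of s] \<open>t < s\<close> \<open>s < n\<close> less.prems by simp
          then show ?thesis by simp
        qed
      qed
    qed (use less.prems in auto)
    finally have "g $$ (t, t) * h $$ (t, j) = 0" using h(2) less.prems by simp
    then show ?case using diag less.prems by simp
  qed
  then show ?thesis using h(1) by (intro upper_triangularI) auto
qed

text \<open>Padding to size \<open>r\<close> makes the matrix a product of two square matrices, so
  the determinant is multiplicative, and the second factor has a zero row because
  \<open>card Q < r\<close>.\<close>

lemma det_sum_rank_one:
  assumes "finite Q" "card Q < r"
  shows "det (mat r r (\<lambda>(i, j). \<Sum>q\<in>Q. u q i * v q j :: complex)) = 0"
proof -
  obtain e where e: "bij_betw e {0..<card Q} Q" using ex_bij_betw_nat_finite[OF assms(1)] by blast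
  \<comment> \<open>For \<open>q \<ge> card Q\<close> the value \<open>e q\<close> is arbitrary;
    those columns of \<open>U\<close> meet the zero rows of \<open>V\<close>.\<close>
  define U where "U = mat r r (\<lambda>(i, q). u (e q) i)"
  define V where "V = mat r r (\<lambda>(q, j). if q < card Q then v (e q) j else 0)"
  have "mat r r (\<lambda>(i, j). \<Sum>q\<in>Q. u q i * v q j) = U * V"
  proof (rule eq_matI)
    fix i j assume "i < dim_row (U * V)" "j < dim_col (U * V)"
    then have ij: "i < r" "j < r" by (auto simp: U_def V_def)
    have "(U * V) $$ (i, j) = (\<Sum>q<r. U $$ (i, q) * V $$ (q, j))"
      using ij by (intro index_mult_mat_sum[of _ r r _ r]) (auto simp: U_def V_def)
    also have "\<dots> = (\<Sum>q\<in>{0..<card Q}. u (e q) i * v (e q) j)"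
      using ij assms(2) by (intro sum.mono_neutral_cong_right) (auto simp: U_def V_def)
    also have "\<dots> = (\<Sum>q\<in>Q. u q i * v q j)" by (rule sum.reindex_bij_betw[OF e])
    finally show "mat r r (\<lambda>(i, j). \<Sum>q\<in>Q. u q i * v q j) $$ (i, j) = (U * V) $$ (i, j)"
      using ij by simp
  qed (auto simp: U_def V_def)
  moreover have "det V = 0"
  proof -
    have V: "V \<in> carrier_mat r r" by (simp add: V_def)
    show ?thesis unfolding det_def'[OF V]
    proof (rule sum.neutral, rule ballI)
      fix p assume "p \<in> {p. p permutes {0..<r}}"
      then have "p (card Q) < r" using assms(2) permutes_in_image[of p "{0..<r}" "card Q"] by auto
      then have "V $$ (card Q, p (card Q)) = 0" using assms(2) by (simp add: V_def)
      then have "(\<Prod>i = 0..<r. V $$ (i, p i)) = 0" using assms(2) by (intro prod_zero) auto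
      then show "signof p * (\<Prod>i = 0..<r. V $$ (i, p i)) = 0" by simp
    qed
  qed
  ultimately show ?thesis by (simp add: det_mult[of _ r] U_def V_def)
qed

section \<open>Orbits of square zero matrices\<close>

text \<open>Sums of at most \<open>k\<close> matrices of rank one; the type of the index set \<open>Q\<close> is immaterial.\<close>

definition rank_le :: "nat \<Rightarrow> complex mat \<Rightarrow> nat \<Rightarrow> bool" where
  "rank_le n A k \<longleftrightarrow> (\<exists>(Q :: (nat \<times> nat) set) u v. finite Q \<and> card Q \<le> k \<and>
     (\<forall>i<n. \<forall>j<n. A $$ (i, j) = (\<Sum>q\<in>Q. u q i * v q j)))"

lemma rank_le_conj:
  assumes A: "rank_le n A k" and c: "g \<in> carrier_mat n n" "A \<in> carrier_mat n n" "h \<in> carrier_mat n n"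
  shows "rank_le n (g * A * h) k"
proof -
  obtain Q :: "(nat \<times> nat) set" and u v where Q: "finite Q" "card Q \<le> k"
    and e: "\<And>i j. i < n \<Longrightarrow> j < n \<Longrightarrow> A $$ (i, j) = (\<Sum>q\<in>Q. u q i * v q j)"
    using A unfolding rank_le_def by blast
  have "(g * A * h) $$ (i, j) = (\<Sum>q\<in>Q. (\<Sum>s<n. g $$ (i, s) * u q s) * (\<Sum>t<n. v q t * h $$ (t, j)))"
    if "i < n" "j < n" for i j
  proof -
    have "(g * A * h) $$ (i, j) = (\<Sum>t<n. \<Sum>s<n. \<Sum>q\<in>Q. g $$ (i, s) * u q s * (v q t * h $$ (t, j)))"
      unfolding index_mult3_mat_sum[OF c that]
      by (intro sum.cong refl) (simp add: e sum_distrib_left sum_distrib_right mult_ac)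
    also have "\<dots> = (\<Sum>t<n. \<Sum>q\<in>Q. \<Sum>s<n. g $$ (i, s) * u q s * (v q t * h $$ (t, j)))"
      by (intro sum.cong refl sum.swap)
    also have "\<dots> = (\<Sum>q\<in>Q. \<Sum>t<n. \<Sum>s<n. g $$ (i, s) * u q s * (v q t * h $$ (t, j)))"
      by (rule sum.swap)
    also have "\<dots> = (\<Sum>q\<in>Q. (\<Sum>s<n. g $$ (i, s) * u q s) * (\<Sum>t<n. v q t * h $$ (t, j)))"
      by (intro sum.cong refl) (simp add: sum_distrib_left sum_distrib_right)
    finally show ?thesis .
  qed
  then show ?thesis unfolding rank_le_def using Q
    by (intro exI[of _ Q] exI[of _ "\<lambda>q i. \<Sum>s<n. g $$ (i, s) * u q s"]
        exI[of _ "\<lambda>q j. \<Sum>t<n. v q t * h $$ (t, j)"]) auto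
qed

lemma rank_le_minor:
  assumes A: "rank_le n A k" "k < r" and lt: "\<And>i. i < r \<Longrightarrow> a i < n \<and> b i < n"
  shows "minor r a b A = 0"
proof -
  obtain Q :: "(nat \<times> nat) set" and u v where Q: "finite Q" "card Q \<le> k"
    and e: "\<And>i j. i < n \<Longrightarrow> j < n \<Longrightarrow> A $$ (i, j) = (\<Sum>q\<in>Q. u q i * v q j)"
    using A unfolding rank_le_def by blast
  have "mat r r (\<lambda>(i, j). A $$ (a i, b j)) = mat r r (\<lambda>(i, j). \<Sum>q\<in>Q. u q (a i) * v q (b j))"
    using lt by (intro eq_matI) (auto simp: e)
  then show ?thesis unfolding minor_def
    using det_sum_rank_one[OF Q(1), of r "\<lambda>q i. u q (a i)" "\<lambda>q j. v q (b j)"] Q(2) A(2) by simp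
qed

section \<open>Matchings as normal forms of square zero matrices\<close>

text \<open>Disjointness of sources and targets is what makes the corresponding 0-1 matrix square to
  zero. These matrices represent the orbits of square zero matrices, and only the size of
  \<open>M\<close> matters for the orbit.\<close>

definition matching :: "nat \<Rightarrow> (nat \<times> nat) set \<Rightarrow> bool" where
  "matching n M \<longleftrightarrow> M \<subseteq> {..<n} \<times> {..<n} \<and> inj_on fst M \<and> inj_on snd M \<and> fst ` M \<inter> snd ` M = {}"

definition matching_mat :: "nat \<Rightarrow> (nat \<times> nat) set \<Rightarrow> complex mat" where
  "matching_mat n M = mat n n (\<lambda>(i, j). if (i, j) \<in> M then 1 else 0)"

lemma matching_mat_carrier [simp]: "matching_mat n M \<in> carrier_mat n n"
  by (simp add: matching_mat_def)

lemma matching_finite: "matching n M \<Longrightarrow> finite M"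
  unfolding matching_def by (auto intro: finite_subset)

lemma matching_mat_square: "matching n M \<Longrightarrow> matching_mat n M * matching_mat n M = 0\<^sub>m n n"
proof (rule eq_matI)
  fix i j assume M: "matching n M" and "i < dim_row (0\<^sub>m n n :: complex mat)" "j < dim_col (0\<^sub>m n n :: complex mat)"
  then have ij: "i < n" "j < n" by auto
  have "(i, k) \<notin> M \<or> (k, j) \<notin> M" for k
    using M unfolding matching_def by (metis IntI empty_iff fst_conv snd_conv image_eqI)
  then have "(\<Sum>k<n. matching_mat n M $$ (i, k) * matching_mat n M $$ (k, j)) = 0"
    using ij by (intro sum.neutral) (auto simp: matching_mat_def)
  then show "(matching_mat n M * matching_mat n M) $$ (i, j) = 0\<^sub>m n n $$ (i, j)"
    using ij index_mult_mat_sum[of "matching_mat n M" n n "matching_mat n M" n i j] by simp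
qed (auto simp: matching_mat_def)

lemma rank_le_matching_mat:
  assumes M: "matching n M"
  shows "rank_le n (matching_mat n M) (card M)"
proof -
  have "matching_mat n M $$ (i, j) = (\<Sum>q\<in>M. (if i = fst q then 1 else 0) * (if j = snd q then 1 else 0))"
    if ij: "i < n" "j < n" for i j
  proof -
    have "(\<Sum>q\<in>M. (if i = fst q then 1 else 0) * (if j = snd q then 1 else 0) :: complex)
        = (\<Sum>q\<in>M. if q = (i, j) then 1 else 0)"
      by (intro sum.cong) auto
    also have "\<dots> = matching_mat n M $$ (i, j)"
      using ij matching_finite[OF M] by (simp add: matching_mat_def)
    finally show ?thesis by simp
  qed
  then show ?thesis unfolding rank_le_def using matching_finite[OF M]
    by (intro exI[of _ M] exI[of _ "\<lambda>q i. if i = fst q then 1 else 0"]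
        exI[of _ "\<lambda>q j. if j = snd q then 1 else 0"]) auto
qed

lemma minor_matching_mat:
  assumes inj: "inj_on a {..<r}" "inj_on b {..<r}" and lt: "\<And>i. i < r \<Longrightarrow> a i < n \<and> b i < n"
  shows "minor r a b (matching_mat n ((\<lambda>i. (a i, b i)) ` {..<r})) = 1"
proof -
  have "(a i, b j) \<in> (\<lambda>i. (a i, b i)) ` {..<r} \<longleftrightarrow> i = j" if "i < r" "j < r" for i j
    using inj that unfolding inj_on_def by auto
  then have "mat r r (\<lambda>(i, j). matching_mat n ((\<lambda>i. (a i, b i)) ` {..<r}) $$ (a i, b j)) = 1\<^sub>m r"
    using lt by (intro eq_matI) (auto simp: matching_mat_def)
  then show ?thesis unfolding minor_def by simp
qed

lemma matching_enumerate:
  assumes M: "matching n M"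
  obtains a b where "M = (\<lambda>i. (a i, b i)) ` {..<card M}" "inj_on a {..<card M}" "inj_on b {..<card M}"
    "\<And>i. i < card M \<Longrightarrow> a i < n \<and> b i < n"
proof -
  obtain e where e: "bij_betw e {0..<card M} M"
    using ex_bij_betw_nat_finite[OF matching_finite[OF M]] by blast
  then have e': "inj_on e {..<card M}" "e ` {..<card M} = M" by (auto simp: bij_betw_def lessThan_atLeast0)
  show thesis
  proof (rule that[of "fst \<circ> e" "snd \<circ> e"])
    show "M = (\<lambda>i. ((fst \<circ> e) i, (snd \<circ> e) i)) ` {..<card M}" using e'(2) by simp
    show "inj_on (fst \<circ> e) {..<card M}" "inj_on (snd \<circ> e) {..<card M}"
      using M e' unfolding matching_def by (auto intro!: comp_inj_on)
    show "(fst \<circ> e) i < n \<and> (snd \<circ> e) i < n" if "i < card M" for i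
    proof -
      have "e i \<in> M" using e'(2) that by blast
      then show ?thesis using M unfolding matching_def by (cases "e i") auto
    qed
  qed
qed

text \<open>Sources, targets and unmatched indices are carried over separately. Every pair uses two
  indices, so equally large matchings leave equally many indices unmatched.\<close>

lemma matching_bij:
  assumes M: "matching n M" and M': "matching n M'" and card: "card M = card M'"
  obtains \<pi> where "bij_betw \<pi> {..<n} {..<n}"
    "\<And>i j. i < n \<Longrightarrow> j < n \<Longrightarrow> (i, j) \<in> M \<longleftrightarrow> (\<pi> i, \<pi> j) \<in> M'"
proof -
  note fin = matching_finite[OF M] matching_finite[OF M']
  obtain f where f: "bij_betw f M M'" using finite_same_card_bij[OF fin card] by blast
  have inj: "inj_on fst M" "inj_on snd M" "inj_on fst M'" "inj_on snd M'"
    and dis: "fst ` M \<inter> snd ` M = {}" "fst ` M' \<inter> snd ` M' = {}"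
    using M M' unfolding matching_def by auto
  have sub: "fst ` M \<union> snd ` M \<subseteq> {..<n}" "fst ` M' \<union> snd ` M' \<subseteq> {..<n}"
    using M M' unfolding matching_def by auto
  define a where "a = fst \<circ> f \<circ> the_inv_into M fst"
  define b where "b = snd \<circ> f \<circ> the_inv_into M snd"
  have a: "bij_betw a (fst ` M) (fst ` M')" unfolding a_def
    using f inj by (intro bij_betw_trans[of _ _ M] bij_betw_trans[of _ _ M'])
      (auto intro: bij_betw_the_inv_into inj_on_imp_bij_betw)
  have b: "bij_betw b (snd ` M) (snd ` M')" unfolding b_def
    using f inj by (intro bij_betw_trans[of _ _ M] bij_betw_trans[of _ _ M'])
      (auto intro: bij_betw_the_inv_into inj_on_imp_bij_betw)
  let ?R = "{..<n} - (fst ` M \<union> snd ` M)" and ?R' = "{..<n} - (fst ` M' \<union> snd ` M')"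
  have cardU: "card (fst ` M \<union> snd ` M) = 2 * card M" "card (fst ` M' \<union> snd ` M') = 2 * card M'"
    using fin dis inj by (simp_all add: card_Un_disjoint card_image)
  have "card ?R = card ?R'"
    using card_Diff_subset[OF _ sub(1)] card_Diff_subset[OF _ sub(2)] fin cardU card by simp
  then obtain c where c: "bij_betw c ?R ?R'" using finite_same_card_bij[of ?R ?R'] by auto
  define \<pi> where "\<pi> i = (if i \<in> fst ` M then a i else if i \<in> snd ` M then b i else c i)" for i
  have 1: "bij_betw \<pi> (fst ` M) (fst ` M')"
    using a by (rule bij_betw_cong[THEN iffD1, rotated]) (simp add: \<pi>_def)
  have 2: "bij_betw \<pi> (snd ` M) (snd ` M')"
    using b by (rule bij_betw_cong[THEN iffD1, rotated]) (use dis(1) in \<open>auto simp: \<pi>_def\<close>)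
  have 3: "bij_betw \<pi> ?R ?R'"
    using c by (rule bij_betw_cong[THEN iffD1, rotated]) (auto simp: \<pi>_def)
  have "bij_betw \<pi> ((fst ` M \<union> snd ` M) \<union> ?R) ((fst ` M' \<union> snd ` M') \<union> ?R')"
    using 1 2 3 dis(2) by (intro bij_betw_combine) auto
  moreover have "(fst ` M \<union> snd ` M) \<union> ?R = {..<n}" "(fst ` M' \<union> snd ` M') \<union> ?R' = {..<n}"
    using sub by auto
  ultimately have \<pi>: "bij_betw \<pi> {..<n} {..<n}" by simp
  have pf: "\<pi> (fst q) = fst (f q)" "\<pi> (snd q) = snd (f q)" if "q \<in> M" for q
  proof -
    show "\<pi> (fst q) = fst (f q)" using that inj by (simp add: \<pi>_def a_def the_inv_into_f_f)
    have "snd q \<notin> fst ` M" using that dis by blast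
    then show "\<pi> (snd q) = snd (f q)" using that inj by (simp add: \<pi>_def b_def the_inv_into_f_f)
  qed
  have "(i, j) \<in> M \<longleftrightarrow> (\<pi> i, \<pi> j) \<in> M'" if ij: "i < n" "j < n" for i j
  proof
    assume "(i, j) \<in> M"
    then show "(\<pi> i, \<pi> j) \<in> M'" using pf[of "(i, j)"] f by (auto simp: bij_betw_def)
  next
    assume "(\<pi> i, \<pi> j) \<in> M'"
    then obtain q where q: "q \<in> M" "f q = (\<pi> i, \<pi> j)" using f by (auto simp: bij_betw_def)
    then have "fst q = i" "snd q = j"
      using pf[OF q(1)] bij_betw_imp_inj_on[OF \<pi>] sub ij by (auto simp: inj_on_def)
    then show "(i, j) \<in> M" using q by (cases q) auto
  qed
  then show thesis using that \<pi> by blast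
qed

lemma similar_matching_mat:
  assumes M: "matching n M" and M': "matching n M'" and card: "card M = card M'"
  shows "similar_mat (matching_mat n M) (matching_mat n M')"
proof -
  obtain \<pi> where \<pi>: "bij_betw \<pi> {..<n} {..<n}"
    and eq: "\<And>i j. i < n \<Longrightarrow> j < n \<Longrightarrow> (i, j) \<in> M \<longleftrightarrow> (\<pi> i, \<pi> j) \<in> M'"
    using matching_bij[OF M M' card] by blast
  define P :: "complex mat" where "P = mat n n (\<lambda>(i, j). if j = \<pi> i then 1 else 0)"
  define Q :: "complex mat" where "Q = mat n n (\<lambda>(i, j). if i = \<pi> j then 1 else 0)"
  have c: "P \<in> carrier_mat n n" "Q \<in> carrier_mat n n" by (auto simp: P_def Q_def)
  have lt: "\<pi> i < n" if "i < n" for i using \<pi> that by (auto simp: bij_betw_def)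
  have inj: "\<pi> i = \<pi> j \<longleftrightarrow> i = j" if "i < n" "j < n" for i j
    using \<pi> that by (auto simp: bij_betw_def inj_on_def)
  have "P * Q = 1\<^sub>m n"
  proof (rule eq_matI)
    fix i j assume "i < dim_row (1\<^sub>m n :: complex mat)" "j < dim_col (1\<^sub>m n :: complex mat)"
    then have ij: "i < n" "j < n" by auto
    have "(P * Q) $$ (i, j) = (\<Sum>k<n. if k = \<pi> i then (if k = \<pi> j then 1 else 0) else 0)"
      unfolding index_mult_mat_sum[OF c ij] using ij by (intro sum.cong) (auto simp: P_def Q_def)
    then show "(P * Q) $$ (i, j) = 1\<^sub>m n $$ (i, j)" using ij lt inj by simp
  qed (use c in auto)
  moreover from this have "Q * P = 1\<^sub>m n" using mat_mult_left_right_inverse[OF c] by blast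
  moreover have "matching_mat n M = P * matching_mat n M' * Q"
  proof (rule eq_matI)
    fix i j assume "i < dim_row (P * matching_mat n M' * Q)" "j < dim_col (P * matching_mat n M' * Q)"
    then have ij: "i < n" "j < n" using c by auto
    have "P $$ (i, s) * matching_mat n M' $$ (s, t) * Q $$ (t, j)
        = (if s = \<pi> i then if t = \<pi> j then matching_mat n M' $$ (s, t) else 0 else 0)"
      if "s < n" "t < n" for s t
      using ij that by (simp add: P_def Q_def)
    then have "(P * matching_mat n M' * Q) $$ (i, j)
        = (\<Sum>t<n. \<Sum>s<n. if s = \<pi> i then if t = \<pi> j then matching_mat n M' $$ (s, t) else 0 else 0)"
      unfolding index_mult3_mat_sum[OF c(1) matching_mat_carrier c(2) ij] by (intro sum.cong refl) simp
    also have "\<dots> = matching_mat n M' $$ (\<pi> i, \<pi> j)"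
      using lt[OF ij(1)] lt[OF ij(2)] by (simp only: sum.delta finite_lessThan lessThan_iff if_True)
    also have "\<dots> = matching_mat n M $$ (i, j)" using ij lt eq by (simp add: matching_mat_def)
    finally show "matching_mat n M $$ (i, j) = (P * matching_mat n M' * Q) $$ (i, j)" by simp
  qed (use c in \<open>auto simp: matching_mat_def\<close>)
  ultimately show ?thesis using c by (intro similar_matI[of _ _ P Q n]) auto
qed

lemma conj_square:
  assumes "g \<in> carrier_mat n n" "h \<in> carrier_mat n n" "A \<in> carrier_mat n n" "h * g = 1\<^sub>m n"
  shows "(g * A * h) * (g * A * h) = g * (A * A) * (h :: complex mat)"
proof -
  have "(g * A * h) * (g * A * h) = (g * A) * ((h * g) * (A * h))"
    using assms(1-3) by (simp add: assoc_mult_mat[of _ n n _ n _ n])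
  also have "\<dots> = (g * A) * (A * h)" using assms by simp
  also have "\<dots> = g * (A * A) * h" using assms(1-3) by (simp add: assoc_mult_mat[of _ n n _ n _ n])
  finally show ?thesis .
qed

lemma jordan_matrix_entries:
  assumes "i < sum_list (map fst n_as)" "j < sum_list (map fst n_as)" "i \<noteq> j"
  shows "jordan_matrix n_as $$ (i, j) = (0 :: complex) \<or> j = Suc i \<and> jordan_matrix n_as $$ (i, j) = 1"
  using assms
proof (induction n_as arbitrary: i j)
  case Nil
  then show ?case by simp
next
  case (Cons na n_as)
  obtain m a where na: "na = (m, a)" by force
  let ?k = "sum_list (map fst n_as)"
  have i: "i < m + ?k" "j < m + ?k" using Cons.prems na by auto
  show ?case
  proof (cases "i < m \<or> j < m")
    case True
    then show ?thesis using i Cons.prems(3) unfolding na jordan_matrix_Cons by auto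
  next
    case False
    then have "j - m = Suc (i - m) \<longleftrightarrow> j = Suc i" "i - m \<noteq> j - m" using Cons.prems(3) by arith+
    then show ?thesis using False Cons.IH[of "i - m" "j - m"] i Cons.prems(3) unfolding na jordan_matrix_Cons
      by auto
  qed
qed

text \<open>Off the diagonal, a Jordan form has only zeros and superdiagonal ones. Square zero then
  forces the diagonal to vanish and excludes two consecutive ones, so the nonzero positions
  \<open>(i, Suc i)\<close> form a matching.\<close>

lemma square_zero_similar_matching_mat:
  assumes X: "X \<in> carrier_mat n n" "X * X = 0\<^sub>m n n"
  obtains M where "matching n M" "similar_mat X (matching_mat n M)"
proof -
  obtain as where "char_poly X = (\<Prod>a\<leftarrow>as. [:- a, 1:])" using char_poly_factorized[OF X(1)] by blast
  then obtain n_as where "jordan_nf X n_as" using jordan_nf_exists[OF X(1)] by blast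
  then have sim: "similar_mat X (jordan_matrix n_as)" by (simp add: jordan_nf_def)
  define J where "J = jordan_matrix n_as"
  obtain P Q where PQ: "similar_mat_wit X J P Q" using sim unfolding similar_mat_def J_def by blast
  have J: "J \<in> carrier_mat n n" using similar_mat_witD2(5)[OF X(1) PQ] .
  have n: "n = sum_list (map fst n_as)" using J unfolding J_def by auto
  have c: "P \<in> carrier_mat n n" "Q \<in> carrier_mat n n" using similar_mat_witD2[OF X(1) PQ] by auto
  have JX: "J = Q * X * P" using similar_mat_witD2[OF J similar_mat_wit_sym[OF PQ]] by simp
  have "J * J = Q * (X * X) * P"
    unfolding JX using similar_mat_witD2(1)[OF X(1) PQ] X(1) c by (intro conj_square) auto
  also have "\<dots> = 0\<^sub>m n n" unfolding X(2) using c by simp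
  finally have JJ: "J * J = 0\<^sub>m n n" .
  have off: "J $$ (i, j) = 0 \<or> j = Suc i \<and> J $$ (i, j) = 1" if "i < n" "j < n" "i \<noteq> j" for i j
    using jordan_matrix_entries[of i n_as j] that unfolding n[symmetric] J_def by simp
  have sq: "(\<Sum>k<n. J $$ (i, k) * J $$ (k, j)) = 0" if "i < n" "j < n" for i j
    using index_mult_mat_sum[OF J J that] JJ that by simp
  \<comment> \<open>In the entry \<open>(i, i)\<close> of \<open>J * J\<close> only
    \<open>k = i\<close> contributes, since two positions mirrored in the diagonal are never both
    nonzero.\<close>
  have diag: "J $$ (i, i) = 0" if i: "i < n" for i
  proof -
    have "J $$ (i, k) * J $$ (k, i) = 0" if k: "k < n" "k \<noteq> i" for k
      using off[of i k] off[of k i] k i by auto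
    then have "(\<Sum>k<n. J $$ (i, k) * J $$ (k, i)) = (\<Sum>k\<in>{i}. J $$ (i, k) * J $$ (k, i))"
      using i by (intro sum.mono_neutral_right) auto
    then show ?thesis using sq[OF i i] by simp
  qed
  have entry: "J $$ (i, j) = 0 \<or> j = Suc i \<and> J $$ (i, j) = 1" if "i < n" "j < n" for i j
    using off[OF that] diag that by (cases "i = j") auto
  \<comment> \<open>The entry \<open>(i, Suc (Suc i))\<close> of \<open>J * J\<close> is the single
    product of two neighbouring superdiagonal entries.\<close>
  have no: "J $$ (i, Suc i) = 0 \<or> J $$ (Suc i, Suc (Suc i)) = 0" if i: "Suc (Suc i) < n" for i
  proof -
    have "J $$ (i, k) * J $$ (k, Suc (Suc i)) = 0" if k: "k < n" "k \<noteq> Suc i" for k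
      using entry[of i k] k i by auto
    then have "(\<Sum>k<n. J $$ (i, k) * J $$ (k, Suc (Suc i)))
        = (\<Sum>k\<in>{Suc i}. J $$ (i, k) * J $$ (k, Suc (Suc i)))"
      using i by (intro sum.mono_neutral_right) auto
    then show ?thesis using sq[of i "Suc (Suc i)"] i by simp
  qed
  define M where "M = {(i, j). i < n \<and> j < n \<and> J $$ (i, j) \<noteq> 0}"
  have MS: "j = Suc i" if "(i, j) \<in> M" for i j using that entry[of i j] unfolding M_def by auto
  have "matching n M"
    unfolding matching_def
  proof (intro conjI)
    show "M \<subseteq> {..<n} \<times> {..<n}" unfolding M_def by auto
    have Mq: "snd q = Suc (fst q)" if "q \<in> M" for q using MS[of "fst q" "snd q"] that by simp
    show "inj_on fst M" by (rule inj_onI) (metis Mq prod.expand)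
    show "inj_on snd M" by (rule inj_onI) (metis Mq Suc_inject prod.expand)
    show "fst ` M \<inter> snd ` M = {}"
    proof (rule ccontr)
      assume "fst ` M \<inter> snd ` M \<noteq> {}"
      then obtain p q r where "(p, q) \<in> M" "(q, r) \<in> M" by force
      then show False using MS[of p q] MS[of q r] no[of p] unfolding M_def by auto
    qed
  qed
  moreover have "J = matching_mat n M"
    using entry J by (intro eq_matI) (auto simp: matching_mat_def M_def)
  ultimately show thesis using that sim unfolding J_def by metis
qed

section \<open>From similarity to conjugation by matrices of determinant one\<close>

lemma complex_nth_root_exists:
  assumes "n \<ge> 1"
  obtains c :: complex where "c ^ n = w"
proof -
  have "rcis (root n (cmod w)) (Arg w / n) ^ n = rcis (cmod w) (Arg w)"
    using assms by (simp add: DeMoivre2)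
  then show thesis using that rcis_cmod_Arg by metis
qed

text \<open>A scalar factor in the base change does not alter the conjugation, so an
  \<open>n\<close>-th root of \<open>inverse (det P)\<close> can bring the determinant to 1.\<close>

lemma similar_mat_conjugates_SL:
  assumes "similar_mat X Y" "X \<in> carrier_mat n n" "n \<ge> 1"
  shows "X \<in> conjugates n (SL n) {Y}"
proof -
  obtain P Q where "similar_mat_wit X Y P Q" using assms(1) unfolding similar_mat_def by blast
  note w = similar_mat_witD2[OF assms(2) this]
  have "det P * det Q = 1" using w(1) det_mult[OF w(6,7)] by simp
  then have dP: "det P \<noteq> 0" by auto
  obtain c where c: "c ^ n = inverse (det P)" using complex_nth_root_exists[OF assms(3)] by blast
  then have c0: "c \<noteq> 0" using dP assms(3) by (auto simp: power_0_left)
  have sm: "(c \<cdot>\<^sub>m A) * (inverse c \<cdot>\<^sub>m B) = A * B" "(inverse c \<cdot>\<^sub>m A) * (c \<cdot>\<^sub>m B) = A * B"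
    if "A \<in> carrier_mat n n" "B \<in> carrier_mat n n" for A B :: "complex mat"
    unfolding mult_smult_distrib[OF smult_carrier_mat[OF that(1)] that(2)] mult_smult_assoc_mat[OF that]
    using c0 by (auto intro!: eq_matI)
  have inv: "(c \<cdot>\<^sub>m P) * (inverse c \<cdot>\<^sub>m Q) = 1\<^sub>m n" "(inverse c \<cdot>\<^sub>m Q) * (c \<cdot>\<^sub>m P) = 1\<^sub>m n"
    using sm[OF w(6,7)] sm[OF w(7,6)] w(1,2) by simp_all
  have "(c \<cdot>\<^sub>m P) * Y = c \<cdot>\<^sub>m (P * Y)" using mult_smult_assoc_mat[OF w(6,5)] .
  then have "X = (c \<cdot>\<^sub>m P) * Y * (inverse c \<cdot>\<^sub>m Q)"
    using sm(1)[OF mult_carrier_mat[OF w(6,5)] w(7)] w(3) by simp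
  moreover have "c \<cdot>\<^sub>m P \<in> SL n" using w c dP by (simp add: SL_def det_smult)
  then have "(c \<cdot>\<^sub>m P) * Y * (inverse c \<cdot>\<^sub>m Q) \<in> conjugates n (SL n) {Y}"
    using w inv by (intro conjugatesI) auto
  ultimately show ?thesis by simp
qed

lemma conjugates_SL_sym:
  assumes "X \<in> conjugates n (SL n) {Y}" "Y \<in> carrier_mat n n"
  shows "Y \<in> conjugates n (SL n) {X}"
proof -
  obtain g h where *: "g \<in> SL n" "g \<in> carrier_mat n n" "h \<in> carrier_mat n n"
    "g * h = 1\<^sub>m n" "h * g = 1\<^sub>m n" "X = g * Y * h"
    using conjugatesE[OF assms(1) SL_carrier] by (metis singletonD)
  have "det g * det h = 1" using *(4) det_mult[OF *(2,3)] by simp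
  then have h: "h \<in> SL n" using * by (simp add: SL_def)
  have "h * X * g = (h * g) * Y * (h * g)"
    unfolding *(6) using conj_mult_assoc[of h n g g h Y] * assms(2) by simp
  also have "\<dots> = Y" using *(5) assms(2) by simp
  finally have "Y = h * X * g" ..
  then show ?thesis using conjugatesI[OF h *(3,2,5,4), of X "{X}"] by simp
qed

lemma conjugates_SL_trans:
  assumes "X \<in> conjugates n (SL n) {Y}" "Y \<in> conjugates n (SL n) {Z}" "Z \<in> carrier_mat n n"
  shows "X \<in> conjugates n (SL n) {Z}"
proof -
  obtain g h where *: "g \<in> SL n" "h \<in> carrier_mat n n"
    "g * h = 1\<^sub>m n" "h * g = 1\<^sub>m n" "X = g * Y * h"
    using conjugatesE[OF assms(1) SL_carrier] by (metis singletonD)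
  then show ?thesis
    using conjugates_conjugates[OF SL_carrier SL_mult _ *(1-4) assms(2)] assms(3) by auto
qed

lemma conjugates_SL_eq:
  assumes "X \<in> conjugates n (SL n) {Y}" "Y \<in> carrier_mat n n"
  shows "conjugates n (SL n) {X} = conjugates n (SL n) {Y}"
proof -
  have "X \<in> carrier_mat n n" using conjugates_carrier[OF SL_carrier, of "{Y}"] assms by auto
  then show ?thesis
    using conjugates_SL_trans[OF _ assms] conjugates_SL_trans[OF _ conjugates_SL_sym[OF assms]] by blast
qed

abbreviation (input) matching_orbit :: "nat \<Rightarrow> (nat \<times> nat) set \<Rightarrow> complex mat set" where
  "matching_orbit n M \<equiv> conjugates n (SL n) {matching_mat n M}"

lemma matching_orbit_carrier: "matching_orbit n M \<subseteq> carrier_mat n n"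
  by (intro conjugates_carrier SL_carrier) simp

lemma matching_mat_in_orbit: "n \<ge> 1 \<Longrightarrow> matching_mat n M \<in> matching_orbit n M"
  by (intro similar_mat_conjugates_SL similar_mat_refl[OF matching_mat_carrier] matching_mat_carrier)

lemma rank_le_matching_orbit:
  assumes "matching n M" "X \<in> matching_orbit n M"
  shows "rank_le n X (card M)"
proof -
  obtain g h where "g \<in> carrier_mat n n" "h \<in> carrier_mat n n" "X = g * matching_mat n M * h"
    using conjugatesE[OF assms(2) SL_carrier] by (metis singletonD)
  then show ?thesis using rank_le_conj[OF rank_le_matching_mat[OF assms(1)]] by simp
qed

lemma square_zero_matching_orbit:
  assumes "matching n M" "X \<in> matching_orbit n M"
  shows "X * X = 0\<^sub>m n n"
proof -
  let ?N = "matching_mat n M"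
  obtain g h where *: "g \<in> carrier_mat n n" "h \<in> carrier_mat n n" "h * g = 1\<^sub>m n" "X = g * ?N * h"
    using conjugatesE[OF assms(2) SL_carrier] by (metis singletonD)
  have "X * X = g * (?N * ?N) * h"
    unfolding *(4) using *(1-3) by (intro conj_square) auto
  also have "\<dots> = 0\<^sub>m n n" using * matching_mat_square[OF assms(1)] by simp
  finally show ?thesis .
qed

lemma square_zero_in_matching_orbit:
  assumes "X \<in> carrier_mat n n" "X * X = 0\<^sub>m n n" "n \<ge> 1"
  obtains M where "matching n M" "X \<in> matching_orbit n M"
  using square_zero_similar_matching_mat[OF assms(1,2)] similar_mat_conjugates_SL[OF _ assms(1,3)] by metis

lemma matching_orbit_eq:
  assumes "matching n M" "matching n M'" "card M = card M'" "n \<ge> 1"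
  shows "matching_orbit n M = matching_orbit n M'"
  using assms by (intro conjugates_SL_eq similar_mat_conjugates_SL similar_matching_mat) auto

section \<open>Rank, closures and uniqueness of the orbit\<close>

lemma minor_zero_closure:
  assumes "S \<subseteq> carrier_mat n n" "\<And>Y. Y \<in> S \<Longrightarrow> rank_le n Y k" "k < r"
    "\<And>i. i < r \<Longrightarrow> a i < n \<and> b i < n" "X \<in> zariski_closure n S"
  shows "minor r a b X = 0"
proof (rule zariski_closureD[OF assms(5,1) minor_polynomial])
  show "a i < n \<and> b i < n" if "i < r" for i using assms(4) that .
  show "minor r a b Y = 0" if "Y \<in> S" for Y
    using rank_le_minor[OF assms(2)[OF that] assms(3), of a b] assms(4) by blast
qed

text \<open>The minor along \<open>M\<close> is 1 at the matching matrix, whereas minors of size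
  above \<open>k\<close> vanish on \<open>S\<close> and hence on its closure.\<close>

lemma matching_mat_in_closure_card_le:
  assumes M: "matching n M" and S: "S \<subseteq> carrier_mat n n" "\<And>Y. Y \<in> S \<Longrightarrow> rank_le n Y k"
    and cl: "matching_mat n M \<in> zariski_closure n S"
  shows "card M \<le> k"
proof (rule ccontr)
  assume "\<not> card M \<le> k"
  obtain a b where ab: "M = (\<lambda>i. (a i, b i)) ` {..<card M}" "inj_on a {..<card M}"
    "inj_on b {..<card M}" "\<And>i. i < card M \<Longrightarrow> a i < n \<and> b i < n"
    using matching_enumerate[OF M] by blast
  have "minor (card M) a b (matching_mat n M) = 0"
    using minor_zero_closure[OF S _ ab(4) cl] \<open>\<not> card M \<le> k\<close> by simp
  moreover have "minor (card M) a b (matching_mat n M) = 1"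
    using minor_matching_mat[OF ab(2-4)] ab(1) by simp
  ultimately show False by simp
qed

lemma square_zero_closure:
  assumes "S \<subseteq> carrier_mat n n" "\<And>Y. Y \<in> S \<Longrightarrow> Y * Y = 0\<^sub>m n n" "X \<in> zariski_closure n S"
  shows "X * X = 0\<^sub>m n n"
proof -
  have X: "X \<in> carrier_mat n n" using zariski_closure_carrier assms by blast
  have "(X * X) $$ (i, j) = 0" if ij: "i < n" "j < n" for i j
  proof -
    have "(\<lambda>X. \<Sum>k<n. X $$ (i, k) * X $$ (k, j)) \<in> polynomial_functions n"
      using ij by (intro polynomial_functions_sum polynomial_functions.intros) auto
    moreover have "(\<Sum>k<n. Y $$ (i, k) * Y $$ (k, j)) = 0" if "Y \<in> S" for Y
      using assms(1,2) that ij index_mult_mat_sum[of Y n n Y n i j] by auto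
    ultimately have "(\<Sum>k<n. X $$ (i, k) * X $$ (k, j)) = 0"
      by (rule zariski_closureD[OF assms(3,1)])
    then show ?thesis using index_mult_mat_sum[OF X X ij] by simp
  qed
  then show ?thesis using X by (intro eq_matI) auto
qed

lemma nilpotent_orbit_matching:
  assumes "matching n M"
  shows "nilpotent_orbit n (matching_orbit n M)"
proof -
  have "matching_mat n M ^\<^sub>m 2 = 0\<^sub>m n n"
    using matching_mat_square[OF assms] by (simp add: numeral_2_eq_2)
  then show ?thesis unfolding nilpotent_orbit_def using matching_mat_carrier by metis
qed

text \<open>Justifies the definite description in \<open>orbit_of_word\<close>. Squaring to zero is
  a closed condition, so a competing orbit also has a matching as representative, and comparing
  ranks in both directions gives matchings of equal size.\<close>

lemma nilpotent_orbit_closure_unique: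
  assumes n: "n \<ge> 1" and M: "matching n M" and O: "nilpotent_orbit n O'"
    and cl: "zariski_closure n O' = zariski_closure n (matching_orbit n M)"
  shows "O' = matching_orbit n M"
proof -
  let ?O = "matching_orbit n M"
  obtain X where X: "X \<in> carrier_mat n n" "O' = conjugates n (SL n) {X}"
    using O unfolding nilpotent_orbit_def by blast
  have "X \<in> O'" unfolding X(2) using X n by (intro similar_mat_conjugates_SL similar_mat_refl)
  then have "X \<in> zariski_closure n ?O" using zariski_closure_subset cl by blast
  then have "X * X = 0\<^sub>m n n"
    using square_zero_closure[OF matching_orbit_carrier] square_zero_matching_orbit[OF M] by blast
  then obtain M' where M': "matching n M'" "X \<in> matching_orbit n M'"
    using square_zero_in_matching_orbit X n by blast
  have O': "O' = matching_orbit n M'"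
    unfolding X(2) using M'(2) by (rule conjugates_SL_eq) simp
  have "matching_mat n M' \<in> zariski_closure n ?O"
    using matching_mat_in_orbit[OF n] O' zariski_closure_subset cl by blast
  then have 1: "card M' \<le> card M"
    by (intro matching_mat_in_closure_card_le[OF M'(1) matching_orbit_carrier rank_le_matching_orbit[OF M]])
  have "matching_mat n M \<in> zariski_closure n (matching_orbit n M')"
    using matching_mat_in_orbit[OF n] zariski_closure_subset cl O' by blast
  then have 2: "card M \<le> card M'"
    by (intro matching_mat_in_closure_card_le[OF M matching_orbit_carrier rank_le_matching_orbit[OF M'(1)]])
  show ?thesis unfolding O' using 1 2 matching_orbit_eq[OF M'(1) M _ n] by simp
qed

text \<open>The normal form of \<open>X\<close> is pinned down by its size, which
  \<open>rank_le\<close> bounds from above and the nonzero minor from below.\<close>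

lemma in_matching_orbit_if_minor:
  assumes n: "n \<ge> 1" and X: "X \<in> carrier_mat n n" "X * X = 0\<^sub>m n n" "rank_le n X (card M)"
    and M: "matching n M" and ab: "\<And>i. i < card M \<Longrightarrow> a i < n \<and> b i < n" "minor (card M) a b X \<noteq> 0"
  shows "X \<in> matching_orbit n M"
proof -
  obtain M' where M': "matching n M'" "X \<in> matching_orbit n M'"
    using square_zero_in_matching_orbit[OF X(1,2) n] by blast
  have "card M \<le> card M'"
  proof (rule ccontr)
    assume "\<not> card M \<le> card M'"
    then have "minor (card M) a b X = 0"
      using ab(1) by (intro rank_le_minor[OF rank_le_matching_orbit[OF M']]) auto
    then show False using ab(2) by simp
  qed
  \<comment> \<open>The upper bound is transported from \<open>X\<close> to its normal form, where a
    minor detects the size; a singleton and its closure suffice for that.\<close>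
  moreover have "matching_mat n M' \<in> conjugates n (SL n) {X}"
    using conjugates_SL_sym[OF M'(2)] by simp
  then obtain g h where "g \<in> carrier_mat n n" "h \<in> carrier_mat n n" "matching_mat n M' = g * X * h"
    using conjugatesE[OF _ SL_carrier] by (metis singletonD)
  then have "rank_le n (matching_mat n M') (card M)" using rank_le_conj[OF X(3)] X(1) by simp
  then have "card M' \<le> card M"
    using matching_mat_in_closure_card_le[OF M'(1), of "{matching_mat n M'}"]
      zariski_closure_subset[of "{matching_mat n M'}" n] by auto
  ultimately show ?thesis using M'(2) matching_orbit_eq[OF M'(1) M _ n] by simp
qed

section \<open>Invariance under Knuth moves\<close>

definition supported_mats :: "nat \<Rightarrow> (nat \<Rightarrow> nat \<Rightarrow> bool) \<Rightarrow> complex mat set" where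
  "supported_mats n R = {X \<in> carrier_mat n n. \<forall>i<n. \<forall>j<n. X $$ (i, j) \<noteq> 0 \<longrightarrow> R i j}"

lemma supported_mats_carrier: "supported_mats n R \<subseteq> carrier_mat n n"
  by (auto simp: supported_mats_def)

lemma supported_mats_line:
  assumes "X \<in> supported_mats n R" "Y \<in> supported_mats n R"
  shows "X + t \<cdot>\<^sub>m (Y - X) \<in> supported_mats n R"
proof -
  have "R i j" if "i < n" "j < n" "X $$ (i, j) + t * (Y $$ (i, j) - X $$ (i, j)) \<noteq> 0" for i j
    using assms that unfolding supported_mats_def by (cases "X $$ (i, j) = 0"; cases "Y $$ (i, j) = 0") auto
  then show ?thesis using assms unfolding supported_mats_def by auto
qed

lemma matching_mat_supported:
  "(\<And>i j. (i, j) \<in> M \<Longrightarrow> R i j) \<Longrightarrow> matching_mat n M \<in> supported_mats n R"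
  by (auto simp: supported_mats_def matching_mat_def split: if_splits)

lemma subset_conjugates_Borel:
  assumes "S \<subseteq> carrier_mat n n"
  shows "S \<subseteq> conjugates n (Borel n) S"
proof
  fix X assume X: "X \<in> S"
  have "1\<^sub>m n \<in> Borel n" by (simp add: Borel_def SL_def)
  from conjugatesI[OF this _ _ _ _ X] have "1\<^sub>m n * X * 1\<^sub>m n \<in> conjugates n (Borel n) S" by simp
  then show "X \<in> conjugates n (Borel n) S" using X assms by auto
qed

text \<open>A nonzero entry at \<open>(u, v)\<close> is a generic condition on the linear space, and
  the matrix unit at that position shows that it can be met. It will be the pivot of an
  elimination.\<close>

lemma supported_mats_subset_closure:
  assumes uv: "u < n" "v < n" "R u v"
    and gen: "\<And>X. X \<in> supported_mats n R \<Longrightarrow> X $$ (u, v) \<noteq> 0 \<Longrightarrow>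
      X \<in> conjugates n (Borel n) (supported_mats n R')"
  shows "supported_mats n R \<subseteq> zariski_closure n (conjugates n (Borel n) (supported_mats n R'))"
proof
  fix X assume X: "X \<in> supported_mats n R"
  show "X \<in> zariski_closure n (conjugates n (Borel n) (supported_mats n R'))"
  proof (rule zariski_closureI)
    fix f assume f: "f \<in> polynomial_functions n"
      "\<And>Y. Y \<in> conjugates n (Borel n) (supported_mats n R') \<Longrightarrow> f Y = 0"
    show "f X = 0"
    proof (rule polynomial_vanishes_if_generically[OF supported_mats_carrier supported_mats_line f(1)
          polynomial_functions.entry[OF uv(1,2)] _ _ _ X])
      show "matching_mat n {(u, v)} \<in> supported_mats n R"
        using uv by (intro matching_mat_supported) auto
      show "matching_mat n {(u, v)} $$ (u, v) \<noteq> 0" using uv by (simp add: matching_mat_def)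
      show "f Z = 0" if "Z \<in> supported_mats n R" "Z $$ (u, v) \<noteq> 0" for Z
        using f(2)[OF gen[OF that]] .
    qed
  qed (use X supported_mats_carrier conjugates_carrier[OF Borel_carrier] in blast)+
qed

lemma elementary_Borel:
  assumes "p < q" "q < n"
  shows "addrow_mat n (t :: complex) p q \<in> Borel n"
  using assms det_addrow_mat[of p q n t] unfolding Borel_def SL_def by (auto intro!: upper_triangularI)

text \<open>Conjugation also produces a term quadratic in \<open>t\<close> at position
  \<open>(p, q)\<close>, with coefficient \<open>X $$ (q, p)\<close>; the hypothesis on this entry
  removes it.\<close>

lemma elementary_conj:
  fixes t :: complex
  assumes X: "X \<in> carrier_mat n n" and pq: "p < q" "q < n" and 0: "X $$ (q, p) = 0"
  obtains Y where "Y \<in> carrier_mat n n"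
    "\<And>i j. i < n \<Longrightarrow> j < n \<Longrightarrow> Y $$ (i, j) =
      X $$ (i, j) - (if j = q then t * X $$ (i, p) else 0) + (if i = p then t * X $$ (q, j) else 0)"
    "\<And>S. Y \<in> S \<Longrightarrow> X \<in> conjugates n (Borel n) S"
proof -
  define g where "g = addrow_mat n t p q"
  define h where "h = addrow_mat n (- t) p q"
  have c: "g \<in> carrier_mat n n" "h \<in> carrier_mat n n" by (simp_all add: g_def h_def)
  have pn: "p < n" "p \<noteq> q" using pq by auto
  have inv: "g * h = 1\<^sub>m n" "h * g = 1\<^sub>m n"
    using addrow_mat_inv[OF pn(1) pq(2) pn(2), of t] addrow_mat_inv[OF pn(1) pq(2) pn(2), of "- t"]
    by (simp_all add: g_def h_def)
  define Y where "Y = g * (X * h)"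
  have "Y = addrow t p q (addcol (- t) q p X)"
    unfolding Y_def g_def h_def addcol_mat[OF X pn(1), symmetric]
    using X pq(2) by (intro addrow_mat[of _ n n, symmetric]) auto
  then have e: "Y $$ (i, j) =
      X $$ (i, j) - (if j = q then t * X $$ (i, p) else 0) + (if i = p then t * X $$ (q, j) else 0)"
    if "i < n" "j < n" for i j
    using that X pq 0 by auto
  have "h * Y * g = (h * g) * X * (h * g)"
    unfolding Y_def using c X by (simp add: assoc_mult_mat[of _ n n _ n _ n])
  then have XY: "X = h * Y * g" using inv X by simp
  have h: "h \<in> Borel n" unfolding h_def using pq by (rule elementary_Borel)
  have "X \<in> conjugates n (Borel n) S" if "Y \<in> S" for S
    unfolding XY using conjugatesI[OF h c(2,1) inv(2,1) that] .
  then show thesis using that[of Y] e c X unfolding Y_def by auto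
qed

text \<open>The conditions on \<open>R\<close> say that adding row \<open>q\<close> to row
  \<open>p\<close> and column \<open>p\<close> to column \<open>q\<close> keeps the support inside
  \<open>R\<close>. The pivot \<open>(q, s)\<close> then clears \<open>(p, s)\<close>, and
  \<open>s \<noteq> q\<close> keeps the column operation away from that position.\<close>

lemma supported_mats_row_elimination:
  assumes pq: "p < q" "q < n" and s: "s < n" "s \<noteq> q" "R q s"
    and R: "\<not> R q p" "\<And>i. R i p \<Longrightarrow> R i q" "\<And>j. R q j \<Longrightarrow> R p j"
    and R': "\<And>i j. R' i j \<longleftrightarrow> R i j \<and> (i, j) \<noteq> (p, s)"
  shows "supported_mats n R \<subseteq> zariski_closure n (conjugates n (Borel n) (supported_mats n R'))"
proof (rule supported_mats_subset_closure[where u = q and v = s, OF pq(2) s(1)])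
  show "R q s" by fact
  fix X assume X: "X \<in> supported_mats n R" and pivot: "X $$ (q, s) \<noteq> 0"
  have pn: "p < n" using pq by simp
  have c: "X \<in> carrier_mat n n" and sup: "\<And>i j. i < n \<Longrightarrow> j < n \<Longrightarrow> X $$ (i, j) \<noteq> 0 \<Longrightarrow> R i j"
    using X unfolding supported_mats_def by auto
  define t where "t = - X $$ (p, s) / X $$ (q, s)"
  have X0: "X $$ (q, p) = 0" using sup[of q p] R(1) pq by auto
  obtain Y where Y: "Y \<in> carrier_mat n n"
    "\<And>i j. i < n \<Longrightarrow> j < n \<Longrightarrow> Y $$ (i, j) =
      X $$ (i, j) - (if j = q then t * X $$ (i, p) else 0) + (if i = p then t * X $$ (q, j) else 0)"
    "\<And>S. Y \<in> S \<Longrightarrow> X \<in> conjugates n (Borel n) S"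
    using elementary_conj[OF c pq X0] by blast
  have Y0: "Y $$ (p, s) = 0" using Y(2)[OF pn s(1)] s(2) pivot by (simp add: t_def)
  have "R' i j" if ij: "i < n" "j < n" and nz: "Y $$ (i, j) \<noteq> 0" for i j
  proof -
    have "X $$ (i, j) \<noteq> 0 \<or> j = q \<and> X $$ (i, p) \<noteq> 0 \<or> i = p \<and> X $$ (q, j) \<noteq> 0"
      using nz unfolding Y(2)[OF ij] by (auto split: if_splits)
    then have "R i j" using sup[OF ij] sup[OF ij(1) pn] sup[OF pq(2) ij(2)] R(2,3) by auto
    then show ?thesis using R' nz Y0 by auto
  qed
  then have "Y \<in> supported_mats n R'" using Y(1) unfolding supported_mats_def by blast
  then show "X \<in> conjugates n (Borel n) (supported_mats n R')" by (rule Y(3))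
qed

text \<open>The same conjugation, used through its column part: the pivot \<open>(s, p)\<close>
  clears \<open>(s, q)\<close>, and \<open>s \<noteq> p\<close> keeps the row operation away from
  it.\<close>

lemma supported_mats_column_elimination:
  assumes pq: "p < q" "q < n" and s: "s < n" "s \<noteq> p" "R s p"
    and R: "\<not> R q p" "\<And>i. R i p \<Longrightarrow> R i q" "\<And>j. R q j \<Longrightarrow> R p j"
    and R': "\<And>i j. R' i j \<longleftrightarrow> R i j \<and> (i, j) \<noteq> (s, q)"
  shows "supported_mats n R \<subseteq> zariski_closure n (conjugates n (Borel n) (supported_mats n R'))"
proof (rule supported_mats_subset_closure[where u = s and v = p, OF s(1)])
  show "R s p" by fact
  show pn: "p < n" using pq by simp
  fix X assume X: "X \<in> supported_mats n R" and pivot: "X $$ (s, p) \<noteq> 0"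
  have c: "X \<in> carrier_mat n n" and sup: "\<And>i j. i < n \<Longrightarrow> j < n \<Longrightarrow> X $$ (i, j) \<noteq> 0 \<Longrightarrow> R i j"
    using X unfolding supported_mats_def by auto
  define t where "t = X $$ (s, q) / X $$ (s, p)"
  have X0: "X $$ (q, p) = 0" using sup[of q p] R(1) pq by auto
  obtain Y where Y: "Y \<in> carrier_mat n n"
    "\<And>i j. i < n \<Longrightarrow> j < n \<Longrightarrow> Y $$ (i, j) =
      X $$ (i, j) - (if j = q then t * X $$ (i, p) else 0) + (if i = p then t * X $$ (q, j) else 0)"
    "\<And>S. Y \<in> S \<Longrightarrow> X \<in> conjugates n (Borel n) S"
    using elementary_conj[OF c pq X0] by blast
  have Y0: "Y $$ (s, q) = 0" using Y(2)[OF s(1) pq(2)] s(2) pivot by (simp add: t_def)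
  have "R' i j" if ij: "i < n" "j < n" and nz: "Y $$ (i, j) \<noteq> 0" for i j
  proof -
    have "X $$ (i, j) \<noteq> 0 \<or> j = q \<and> X $$ (i, p) \<noteq> 0 \<or> i = p \<and> X $$ (q, j) \<noteq> 0"
      using nz unfolding Y(2)[OF ij] by (auto split: if_splits)
    then have "R i j" using sup[OF ij] sup[OF ij(1) pn] sup[OF pq(2) ij(2)] R(2,3) by auto
    then show ?thesis using R' nz Y0 by auto
  qed
  then have "Y \<in> supported_mats n R'" using Y(1) unfolding supported_mats_def by blast
  then show "X \<in> conjugates n (Borel n) (supported_mats n R')" by (rule Y(3))
qed

lemma nil_inter_supported:
  assumes "set w = {1..n}"
  shows "nil_inter n w = supported_mats n (\<lambda>i j. increasing_pair w (Suc i) (Suc j))"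
  unfolding nil_inter_eq supported_mats_def increasing_pair_def assms by (auto; fastforce)

lemma position_append:
  "position (u @ v) x = (if x \<in> set u then position u x else length u + position v x)"
  unfolding position_def by (induction u) auto

lemma position_le_length: "x \<in> set u \<Longrightarrow> position u x \<le> length u"
  unfolding position_def by (induction u) auto

text \<open>These facts feed the row elimination with \<open>a\<close>, \<open>b\<close>,
  \<open>c\<close> as \<open>p\<close>, \<open>q\<close>, \<open>s\<close>: the move breaks only the
  pair \<open>(a, c)\<close>, and \<open>(b, c)\<close> is the pivot.\<close>

lemma increasing_pair_bac:
  assumes d: "distinct (u @ [b, a, c] @ v)" and abc: "a < b" "b < c"
  shows "increasing_pair (u @ [b, c, a] @ v) x y \<longleftrightarrow> increasing_pair (u @ [b, a, c] @ v) x y \<and> (x, y) \<noteq> (a, c)"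
    "increasing_pair (u @ [b, a, c] @ v) x a \<Longrightarrow> increasing_pair (u @ [b, a, c] @ v) x b"
    "increasing_pair (u @ [b, a, c] @ v) b y \<Longrightarrow> increasing_pair (u @ [b, a, c] @ v) a y"
    "increasing_pair (u @ [b, a, c] @ v) b c"
  using d abc position_le_length[of x u] position_le_length[of y u] position_pos[of v x] position_pos[of v y]
    position_pos[of u x] position_pos[of u y]
  unfolding increasing_pair_def by (auto simp: position_append position_Cons split: if_splits)

text \<open>The counterpart for the column elimination, with \<open>b\<close>, \<open>c\<close>,
  \<open>a\<close> as \<open>p\<close>, \<open>q\<close>, \<open>s\<close>: again only
  \<open>(a, c)\<close> is broken, and the pivot is \<open>(a, b)\<close>.\<close>

lemma increasing_pair_acb:
  assumes d: "distinct (u @ [a, c, b] @ v)" and abc: "a < b" "b < c"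
  shows "increasing_pair (u @ [c, a, b] @ v) x y \<longleftrightarrow> increasing_pair (u @ [a, c, b] @ v) x y \<and> (x, y) \<noteq> (a, c)"
    "increasing_pair (u @ [a, c, b] @ v) x b \<Longrightarrow> increasing_pair (u @ [a, c, b] @ v) x c"
    "increasing_pair (u @ [a, c, b] @ v) c y \<Longrightarrow> increasing_pair (u @ [a, c, b] @ v) b y"
    "increasing_pair (u @ [a, c, b] @ v) a b"
  using d abc position_le_length[of x u] position_le_length[of y u] position_pos[of v x] position_pos[of v y]
    position_pos[of u x] position_pos[of u y]
  unfolding increasing_pair_def by (auto simp: position_append position_Cons split: if_splits)


text \<open>Kept general in \<open>H\<close> because the definition of the variety uses two
  saturations, by \<open>Borel n\<close> and by \<open>SL n\<close>; density under the smaller group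
  settles both.\<close>

lemma closure_conjugates_eq:
  assumes H: "Borel n \<subseteq> H" "H \<subseteq> carrier_mat n n" "\<And>g g'. g \<in> H \<Longrightarrow> g' \<in> H \<Longrightarrow> g * g' \<in> H"
    and S: "S \<subseteq> carrier_mat n n" "S' \<subseteq> carrier_mat n n"
    and cl: "S \<subseteq> zariski_closure n (conjugates n (Borel n) S')"
      "S' \<subseteq> zariski_closure n (conjugates n (Borel n) S)"
  shows "zariski_closure n (conjugates n H S) = zariski_closure n (conjugates n H S')"
proof -
  have "zariski_closure n (conjugates n H S) \<subseteq> zariski_closure n (conjugates n H S')"
    if "S \<subseteq> carrier_mat n n" "S' \<subseteq> carrier_mat n n"
      "S \<subseteq> zariski_closure n (conjugates n (Borel n) S')" for S S'
  proof (rule zariski_closure_least, rule conjugates_subset_closure[OF H(2,3) that(2,1)])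
    have "conjugates n (Borel n) S' \<subseteq> zariski_closure n (conjugates n H S')"
      using conjugates_mono[OF H(1) subset_refl] zariski_closure_subset by blast
    then show "S \<subseteq> zariski_closure n (conjugates n H S')"
      using that(3) zariski_closure_least by blast
  qed
  from this[OF S cl(1)] this[OF S(2,1) cl(2)] show ?thesis by blast
qed

lemma knuth_equiv_set_distinct:
  "knuth_equiv w w' \<Longrightarrow> set w = set w' \<and> (distinct w \<longleftrightarrow> distinct w')"
  by (induction rule: knuth_equiv.induct) auto

lemma nil_inter_carrier: "nil_inter n w \<subseteq> carrier_mat n n"
  unfolding nil_inter_eq by blast

abbreviation (input) Borel_closure :: "nat \<Rightarrow> nat list \<Rightarrow> complex mat set" where
  "Borel_closure n w \<equiv> zariski_closure n (conjugates n (Borel n) (nil_inter n w))"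

lemma knuth_step_nil_inter:
  assumes w: "set w = {1..n}" "set w' = {1..n}"
    and eq: "\<And>x y. increasing_pair w' x y \<longleftrightarrow> increasing_pair w x y \<and> (x, y) \<noteq> (a, c)"
    and dense: "nil_inter n w \<subseteq> Borel_closure n w'"
  shows "nil_inter n w \<subseteq> Borel_closure n w' \<and> nil_inter n w' \<subseteq> Borel_closure n w"
proof -
  have "nil_inter n w' \<subseteq> nil_inter n w"
    unfolding nil_inter_supported[OF w(1)] nil_inter_supported[OF w(2)] supported_mats_def using eq by blast
  also have "\<dots> \<subseteq> Borel_closure n w"
    using subset_conjugates_Borel[OF nil_inter_carrier] zariski_closure_subset by blast
  finally show ?thesis using dense by blast
qed

text \<open>The symmetric form of the conclusion is what lets the rules \<open>knuth_sym\<close> and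
  \<open>knuth_trans\<close> go through. For a single move one inclusion comes from containment of
  the spaces, the other from elimination.\<close>

lemma knuth_equiv_nil_inter:
  assumes "knuth_equiv w w'" "distinct w" "set w = {1..n}"
  shows "nil_inter n w \<subseteq> Borel_closure n w' \<and> nil_inter n w' \<subseteq> Borel_closure n w"
  using assms
proof (induction rule: knuth_equiv.induct)
  case (knuth_refl w)
  then show ?case
    using subset_conjugates_Borel[OF nil_inter_carrier] zariski_closure_subset by blast
next
  case (knuth_sym w w')
  then show ?case using knuth_equiv_set_distinct[of w w'] by auto
next
  case (knuth_trans w w' w'')
  then have 1: "nil_inter n w \<subseteq> Borel_closure n w' \<and> nil_inter n w' \<subseteq> Borel_closure n w"
    and 2: "nil_inter n w' \<subseteq> Borel_closure n w'' \<and> nil_inter n w'' \<subseteq> Borel_closure n w'"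
    using knuth_equiv_set_distinct[of w w'] by auto
  have "Borel_closure n w = Borel_closure n w'" "Borel_closure n w' = Borel_closure n w''"
    using 1 2 by (intro closure_conjugates_eq subset_refl Borel_carrier Borel_mult nil_inter_carrier; blast)+
  then show ?case using 1 2 by simp
next
  case (bac_bca a b c u v)
  let ?w = "u @ [b, a, c] @ v" and ?w' = "u @ [b, c, a] @ v"
  note inc = increasing_pair_bac[OF bac_bca(3,1,2)]
  have w': "set ?w' = {1..n}" using bac_bca(4) by auto
  have mem: "a \<in> {1..n}" "b \<in> {1..n}" "c \<in> {1..n}" unfolding bac_bca(4)[symmetric] by auto
  let ?R = "\<lambda>i j. increasing_pair ?w (Suc i) (Suc j)" and ?R' = "\<lambda>i j. increasing_pair ?w' (Suc i) (Suc j)"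
  have "supported_mats n ?R \<subseteq> zariski_closure n (conjugates n (Borel n) (supported_mats n ?R'))"
  proof (rule supported_mats_row_elimination[where p = "a - 1" and q = "b - 1" and s = "c - 1"])
    show "\<not> increasing_pair ?w (Suc (b - 1)) (Suc (a - 1))"
      using mem bac_bca(1) unfolding increasing_pair_def by auto
    show "increasing_pair ?w' (Suc i) (Suc j) \<longleftrightarrow>
        increasing_pair ?w (Suc i) (Suc j) \<and> (i, j) \<noteq> (a - 1, c - 1)" for i j
      unfolding inc(1) using mem by auto
  qed (use mem bac_bca(1,2) inc(2-4) in auto)
  then have "nil_inter n ?w \<subseteq> Borel_closure n ?w'"
    unfolding nil_inter_supported[OF bac_bca(4)] nil_inter_supported[OF w'] .
  from knuth_step_nil_inter[OF bac_bca(4) w' inc(1) this] show ?case .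
next
  case (acb_cab a b c u v)
  let ?w = "u @ [a, c, b] @ v" and ?w' = "u @ [c, a, b] @ v"
  note inc = increasing_pair_acb[OF acb_cab(3,1,2)]
  have w': "set ?w' = {1..n}" using acb_cab(4) by auto
  have mem: "a \<in> {1..n}" "b \<in> {1..n}" "c \<in> {1..n}" unfolding acb_cab(4)[symmetric] by auto
  let ?R = "\<lambda>i j. increasing_pair ?w (Suc i) (Suc j)" and ?R' = "\<lambda>i j. increasing_pair ?w' (Suc i) (Suc j)"
  have "supported_mats n ?R \<subseteq> zariski_closure n (conjugates n (Borel n) (supported_mats n ?R'))"
  proof (rule supported_mats_column_elimination[where p = "b - 1" and q = "c - 1" and s = "a - 1"])
    show "\<not> increasing_pair ?w (Suc (c - 1)) (Suc (b - 1))"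
      using mem acb_cab(2) unfolding increasing_pair_def by auto
    show "increasing_pair ?w' (Suc i) (Suc j) \<longleftrightarrow>
        increasing_pair ?w (Suc i) (Suc j) \<and> (i, j) \<noteq> (a - 1, c - 1)" for i j
      unfolding inc(1) using mem by auto
  qed (use mem acb_cab(1,2) inc(2-4) in auto)
  then have "nil_inter n ?w \<subseteq> Borel_closure n ?w'"
    unfolding nil_inter_supported[OF acb_cab(4)] nil_inter_supported[OF w'] .
  from knuth_step_nil_inter[OF acb_cab(4) w' inc(1) this] show ?case .
qed

lemma orbital_variety_of_word_knuth:
  assumes "knuth_equiv w w'" "distinct w" "set w = {1..n}"
  shows "orbital_variety_of_word n w = orbital_variety_of_word n w'"
proof -
  note cl = knuth_equiv_nil_inter[OF assms]
  have "Borel_closure n w = Borel_closure n w'"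
    using cl by (intro closure_conjugates_eq subset_refl Borel_carrier Borel_mult nil_inter_carrier; blast)
  moreover have "zariski_closure n (conjugates n (SL n) (nil_inter n w))
      = zariski_closure n (conjugates n (SL n) (nil_inter n w'))"
    using cl by (intro closure_conjugates_eq Borel_subset_SL SL_carrier SL_mult nil_inter_carrier; blast)
  ultimately show ?thesis unfolding orbital_variety_of_word_def orbit_of_word_def by simp
qed

text \<open>The word \<open>w\<close> itself shows that the choice by \<open>SOME\<close> is not
  vacuous, and the chosen word is Knuth equivalent to \<open>w\<close> because both have the tableau
  \<open>T\<close>.\<close>

lemma orbital_variety_eq:
  assumes w: "distinct w" "set w = {1..n}" "tableau_of_word w = T"
  shows "orbital_variety n T = orbital_variety_of_word n w"
proof -
  let ?P = "\<lambda>w. w \<in> permutations_of_set {1..n} \<and> tableau_of_word w = T"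
  have "?P w" using w by (auto simp: permutations_of_set_def)
  then have v: "?P (SOME w. ?P w)" by (rule someI)
  define v where "v = (SOME w. ?P w)"
  have "?P v" using v unfolding v_def .
  then have "distinct v" "set v = {1..n}" "tableau_of_word v = T" by (auto simp: permutations_of_set_def)
  then have "orbital_variety_of_word n v = orbital_variety_of_word n w"
    using w by (intro orbital_variety_of_word_knuth knuth_equiv_if_same_tableau) auto
  then show ?thesis unfolding orbital_variety_def v_def .
qed

section \<open>The orbital variety of a two-column tableau\<close>

text \<open>Letters start from 1, matrix indices from 0.\<close>

definition columns_mats :: "nat \<Rightarrow> nat set \<Rightarrow> nat set \<Rightarrow> complex mat set" where
  "columns_mats n A E = supported_mats n (\<lambda>i j. linked A E (Suc i) (Suc j))"

lemma nil_inter_two_columns: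
  assumes "two_columns C D w" "set w = {1..n}"
  shows "nil_inter n w = columns_mats n (set C) (set D)"
  unfolding nil_inter_supported[OF assms(2)] columns_mats_def increasing_pair_iff_linked[OF assms(1)] ..

lemma columns_mats_square_zero:
  assumes "A \<inter> E = {}" "X \<in> columns_mats n A E"
  shows "X * X = 0\<^sub>m n n"
proof -
  have X: "X \<in> carrier_mat n n"
    and l: "\<And>i j. i < n \<Longrightarrow> j < n \<Longrightarrow> X $$ (i, j) \<noteq> 0 \<Longrightarrow> linked A E (Suc i) (Suc j)"
    using assms(2) unfolding columns_mats_def supported_mats_def by auto
  have "X $$ (i, k) * X $$ (k, j) = 0" if "i < n" "j < n" "k < n" for i j k
    using l[of i k] l[of k j] that assms(1) unfolding linked_def by auto
  then show ?thesis using X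
    by (intro eq_matI) (auto simp: index_mult_mat_sum[OF X X] simp del: index_mult_mat(1) intro!: sum.neutral)
qed

lemma columns_mats_rank_le:
  assumes "finite E" "X \<in> columns_mats n A E"
  shows "rank_le n X (card E)"
proof -
  have l: "\<And>i j. i < n \<Longrightarrow> j < n \<Longrightarrow> X $$ (i, j) \<noteq> 0 \<Longrightarrow> linked A E (Suc i) (Suc j)"
    using assms(2) unfolding columns_mats_def supported_mats_def by auto
  \<comment> \<open>One rank one term for each possibly nonzero column. The second component is a
    dummy that fits the index type of \<open>rank_le\<close>, and subtracting 1 turns letters into
    indices.\<close>
  let ?Q = "(\<lambda>y. (y - 1, 0 :: nat)) ` E"
  have "X $$ (i, j) = (\<Sum>q\<in>?Q. X $$ (i, fst q) * (if j = fst q then 1 else 0))" if ij: "i < n" "j < n" for i j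
  proof (cases "X $$ (i, j) = 0")
    case True
    then have "(\<Sum>q\<in>?Q. X $$ (i, fst q) * (if j = fst q then 1 else 0)) = 0" by (intro sum.neutral) auto
    then show ?thesis using True by simp
  next
    case False
    then have "Suc j \<in> E" using l[OF ij] unfolding linked_def by simp
    then have "(j, 0) \<in> ?Q" by force
    moreover have "(\<Sum>q\<in>?Q. X $$ (i, fst q) * (if j = fst q then 1 else 0)) = (\<Sum>q\<in>?Q. if q = (j, 0) then X $$ (i, j) else 0)"
      by (intro sum.cong) auto
    ultimately show ?thesis using assms(1) by simp
  qed
  moreover have "card ?Q \<le> card E" "finite ?Q" using assms(1) by (auto intro: card_image_le)
  ultimately show ?thesis unfolding rank_le_def
    by (intro exI[of _ ?Q] exI[of _ "\<lambda>q i. X $$ (i, fst q)"] exI[of _ "\<lambda>q j. if j = fst q then 1 else 0"]) auto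
qed

lemma two_columns_matching_mat:
  assumes tc: "two_columns C D w" and w: "set w = {1..n}"
  obtains M where "matching n M" "card M = card (set D)" "matching_mat n M \<in> columns_mats n (set C) (set D)"
proof -
  obtain M where M: "finite M" "\<forall>(x, y)\<in>M. increasing_pair w x y"
     "inj_on fst M" "inj_on snd M" "snd ` M = set D" using two_columns_matching[OF tc] by blast
  have l: "linked (set C) (set D) (fst q) (snd q)" if "q \<in> M" for q
    using M(2) that increasing_pair_iff_linked[OF tc] by (cases q) auto
  note tw = two_columns_basic[OF tc]
  have r: "fst q \<in> set C" "snd q \<in> set D" "fst q \<in> {1..n}" "snd q \<in> {1..n}" if "q \<in> M" for q
    using l[OF that] tw(2) w unfolding linked_def by auto
  let ?f = "\<lambda>q. (fst q - 1, snd q - 1)"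
  have inj: "inj_on (\<lambda>q. fst q - 1) M" "inj_on (\<lambda>q. snd q - 1) M"
    using M(3,4) r(3,4) unfolding inj_on_def by (metis atLeastAtMost_iff le_add_diff_inverse)+
  then have injf: "inj_on ?f M" unfolding inj_on_def by auto
  have lf: "linked (set C) (set D) (Suc (fst q - 1)) (Suc (snd q - 1))" if "q \<in> M" for q
    using l[OF that] r[OF that] by simp
  show thesis
  proof (rule that[of "?f ` M"])
    show "matching n (?f ` M)"
      unfolding matching_def
    proof (intro conjI)
      have "fst q - 1 < n \<and> snd q - 1 < n" if "q \<in> M" for q using r(3,4)[OF that] by auto
      then show "?f ` M \<subseteq> {..<n} \<times> {..<n}" by auto
      show "inj_on fst (?f ` M)" "inj_on snd (?f ` M)" using inj unfolding inj_on_def by auto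
      have "fst q - 1 \<noteq> snd q' - 1" if "q \<in> M" "q' \<in> M" for q q'
        using r(1,3)[OF that(1)] r(2,4)[OF that(2)] tw(3) by (metis IntI atLeastAtMost_iff empty_iff le_add_diff_inverse)
      then show "fst ` ?f ` M \<inter> snd ` ?f ` M = {}" by force
    qed
    have "card M = card (set D)" using card_image[OF M(4)] M(5) by simp
    then show "card (?f ` M) = card (set D)" using card_image[OF injf] by simp
    show "matching_mat n (?f ` M) \<in> columns_mats n (set C) (set D)"
      unfolding columns_mats_def using lf by (intro matching_mat_supported) auto
  qed
qed

text \<open>Ranks in the space are at most \<open>card E\<close>, so a nonzero minor along
  \<open>M\<close> suffices for membership in the orbit, and this minor is nonzero at the matching
  matrix. Vanishing on the part in the orbit therefore spreads to the whole space.\<close>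

lemma columns_mats_generic:
  assumes n: "n \<ge> 1" and fin: "finite E" and disj: "A \<inter> E = {}"
    and M: "matching n M" "card M = card E" "matching_mat n M \<in> columns_mats n A E"
    and f: "f \<in> polynomial_functions n"
    and gen: "\<And>X. X \<in> columns_mats n A E \<Longrightarrow> X \<in> matching_orbit n M \<Longrightarrow> f X = 0"
    and X: "X \<in> columns_mats n A E"
  shows "f X = 0"
proof -
  obtain a b where ab: "M = (\<lambda>i. (a i, b i)) ` {..<card M}" "inj_on a {..<card M}"
    "inj_on b {..<card M}" "\<And>i. i < card M \<Longrightarrow> a i < n \<and> b i < n"
    using matching_enumerate[OF M(1)] by blast
  have one: "minor (card M) a b (matching_mat n M) = 1"
    using minor_matching_mat[OF ab(2-4)] ab(1) by simp
  have orb: "Z \<in> matching_orbit n M" if Z: "Z \<in> columns_mats n A E" "minor (card M) a b Z \<noteq> 0" for Z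
  proof (rule in_matching_orbit_if_minor[OF n _ _ _ M(1) ab(4) Z(2)])
    show "Z \<in> carrier_mat n n" using Z(1) supported_mats_carrier unfolding columns_mats_def by blast
    show "Z * Z = 0\<^sub>m n n" using columns_mats_square_zero[OF disj Z(1)] .
    show "rank_le n Z (card M)" using columns_mats_rank_le[OF fin Z(1)] M(2) by simp
  qed
  show ?thesis
  proof (rule polynomial_vanishes_if_generically[where L = "columns_mats n A E" and f = f
        and q = "minor (card M) a b" and Y = "matching_mat n M"])
    show "minor (card M) a b \<in> polynomial_functions n" using ab(4) by (rule minor_polynomial)
    show "minor (card M) a b (matching_mat n M) \<noteq> 0" using one by simp
    show "f Z = 0" if "Z \<in> columns_mats n A E" "minor (card M) a b Z \<noteq> 0" for Z
      using gen[OF that(1) orb[OF that]] .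
  qed (use f M(3) X supported_mats_carrier supported_mats_line in \<open>auto simp: columns_mats_def\<close>)
qed

text \<open>Intersecting with the orbit loses nothing in the closure, because the orbit contains a
  dense part of every conjugate of the space.\<close>

lemma orbital_variety_closure:
  assumes n: "n \<ge> 1" and tc: "two_columns C D w" and w: "set w = {1..n}"
  shows "zariski_closure n (orbital_variety_of_word n w) = Borel_closure n w"
proof -
  note tw = two_columns_basic[OF tc]
  let ?L = "columns_mats n (set C) (set D)"
  have L: "nil_inter n w = ?L" using nil_inter_two_columns[OF tc w] .
  have Lc: "?L \<subseteq> carrier_mat n n" unfolding columns_mats_def by (rule supported_mats_carrier)
  obtain M where M: "matching n M" "card M = card (set D)" "matching_mat n M \<in> ?L"
    using two_columns_matching_mat[OF tc w] by blast
  note gen = columns_mats_generic[OF n finite_set tw(3) M]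
  have orbc: "matching_orbit n M \<subseteq> carrier_mat n n" by (rule matching_orbit_carrier)
  have "?L \<subseteq> zariski_closure n (matching_orbit n M)"
  proof
    fix X assume X: "X \<in> ?L"
    show "X \<in> zariski_closure n (matching_orbit n M)"
      by (rule zariski_closureI[OF orbc]) (use X Lc gen in blast)+
  qed
  then have "conjugates n (SL n) ?L \<subseteq> zariski_closure n (matching_orbit n M)"
    using Lc by (intro conjugates_subset_closure SL_carrier SL_mult) auto
  moreover have "matching_orbit n M \<subseteq> conjugates n (SL n) ?L" using M(3) by (intro conjugates_mono) auto
  ultimately have cl: "zariski_closure n (conjugates n (SL n) ?L) = zariski_closure n (matching_orbit n M)"
    using zariski_closure_least zariski_closure_subset by (metis subset_antisym subset_trans)
  have orb: "orbit_of_word n w = matching_orbit n M"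
    unfolding orbit_of_word_def L
  proof (rule the_equality)
    show "nilpotent_orbit n (matching_orbit n M) \<and>
        zariski_closure n (conjugates n (SL n) ?L) = zariski_closure n (matching_orbit n M)"
      using nilpotent_orbit_matching[OF M(1)] cl by blast
    show "O' = matching_orbit n M" if "nilpotent_orbit n O' \<and>
        zariski_closure n (conjugates n (SL n) ?L) = zariski_closure n O'" for O'
      using that cl by (intro nilpotent_orbit_closure_unique[OF n M(1)]) auto
  qed
  let ?V = "orbital_variety_of_word n w"
  have V: "?V = zariski_closure n (conjugates n (Borel n) ?L) \<inter> matching_orbit n M"
    unfolding orbital_variety_of_word_def orb L ..
  then have Vc: "?V \<subseteq> carrier_mat n n" using orbc by blast
  have "conjugates n (Borel n) ?L \<subseteq> zariski_closure n ?V"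
  proof
    fix Y assume Y: "Y \<in> conjugates n (Borel n) ?L"
    then obtain g h X where *: "g \<in> Borel n" "g \<in> carrier_mat n n" "h \<in> carrier_mat n n"
      "g * h = 1\<^sub>m n" "h * g = 1\<^sub>m n" "X \<in> ?L" "Y = g * X * h"
      using conjugatesE[OF _ Borel_carrier] by metis
    show "Y \<in> zariski_closure n ?V"
    proof (rule zariski_closureI[OF Vc])
      show "Y \<in> carrier_mat n n" using * Lc by auto
      fix f assume f: "f \<in> polynomial_functions n" "\<And>Y. Y \<in> ?V \<Longrightarrow> f Y = 0"
      obtain f' where f': "f' \<in> polynomial_functions n" "\<And>X. X \<in> carrier_mat n n \<Longrightarrow> f' X = f (g * X * h)"
        using polynomial_functions_conj[OF f(1) *(2,3)] by blast
      \<comment> \<open>The pulled back \<open>f'\<close> is examined on the linear space, where the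
        generic argument is available; conjugation by \<open>g\<close> brings a generic
        \<open>Z\<close> into both the orbit and the saturation.\<close>
      have "f' X = 0"
      proof (rule gen[OF f'(1) _ *(6)])
        fix Z assume Z: "Z \<in> ?L" "Z \<in> matching_orbit n M"
        have "g \<in> SL n" using * Borel_subset_SL by blast
        then have "g * Z * h \<in> matching_orbit n M"
          using conjugates_conjugates[OF SL_carrier SL_mult _ _ *(3-5) Z(2)] by simp
        moreover have "g * Z * h \<in> conjugates n (Borel n) ?L" using conjugatesI[OF *(1-5) Z(1)] .
        ultimately have "g * Z * h \<in> ?V" unfolding V using zariski_closure_subset by blast
        then show "f' Z = 0" using f(2) f'(2) Z(1) Lc by auto
      qed
      then show "f Y = 0" using f'(2)[of X] * Lc by auto
    qed
  qed
  then have "zariski_closure n (conjugates n (Borel n) ?L) \<subseteq> zariski_closure n ?V"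
    by (rule zariski_closure_least)
  moreover have "zariski_closure n ?V \<subseteq> zariski_closure n (conjugates n (Borel n) ?L)"
    unfolding V by (rule zariski_closure_least) blast
  ultimately show ?thesis unfolding L by blast
qed

text \<open>Only the entries \<open>(x, y)\<close> with \<open>z \<le> x < y \<le> e\<close> contribute to the minor, and these lie in the rows
  \<open>x < c\<close> with \<open>x \<in> A\<close> or in the columns \<open>y \<ge> c\<close> with \<open>y \<in> E\<close>.\<close>

lemma minor_cut:
  assumes Y: "Y \<in> conjugates n (Borel n) (columns_mats n A E)" and disj: "A \<inter> E = {}" and fin: "finite A" "finite E"
    and a: "\<And>i. i < r \<Longrightarrow> z \<le> Suc (a i) \<and> a i < n" and b: "\<And>i. i < r \<Longrightarrow> Suc (b i) \<le> e \<and> b i < n"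
    and less: "card (A \<inter> {z..<c}) + card (E \<inter> {c..e}) < r"
  shows "minor r a b Y = 0"
proof -
  obtain g h X where *: "g \<in> Borel n" "g \<in> carrier_mat n n" "h \<in> carrier_mat n n"
    "g * h = 1\<^sub>m n" "h * g = 1\<^sub>m n" "X \<in> columns_mats n A E" "Y = g * X * h"
    using conjugatesE[OF Y Borel_carrier] by metis
  have X: "X \<in> carrier_mat n n"
    and l: "\<And>i j. i < n \<Longrightarrow> j < n \<Longrightarrow> X $$ (i, j) \<noteq> 0 \<Longrightarrow> linked A E (Suc i) (Suc j)"
    using *(6) unfolding columns_mats_def supported_mats_def by auto
  have ug: "upper_triangular g" using *(1) by (simp add: Borel_def)
  have uh: "upper_triangular h" using Borel_inverse_upper_triangular[OF *(1,3,4)] .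
  \<comment> \<open>Triangularity confines the sum: row \<open>a i\<close> of \<open>g\<close>
    reaches no row of \<open>X\<close> with label below \<open>z\<close>, and column
    \<open>b j\<close> of \<open>h\<close> reaches no column with label beyond
    \<open>e\<close>.\<close>
  have g0: "g $$ (a i, s) = 0" if "i < r" "Suc s < z" for i s
    using upper_triangularD[OF ug, of s "a i"] a[OF that(1)] that(2) *(2) by auto
  have h0: "h $$ (t, b j) = 0" if "j < r" "t < n" "e < Suc t" for j t
    using upper_triangularD[OF uh, of "b j" t] b[OF that(1)] that *(3) by auto
  let ?A = "{s. Suc s \<in> A \<and> z \<le> Suc s \<and> Suc s < c \<and> s < n}"
  let ?E = "{t. Suc t \<in> E \<and> c \<le> Suc t \<and> Suc t \<le> e \<and> t < n}"
  let ?Q = "(\<lambda>s. (s, 0 :: nat)) ` ?A \<union> (\<lambda>t. (t, 1)) ` ?E"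
  define u where "u q i = (if snd q = 0 then g $$ (a i, fst q)
    else (\<Sum>s<n. if Suc s < c then 0 else g $$ (a i, s) * X $$ (s, fst q)))" for q :: "nat \<times> nat" and i
  define v where "v q j = (if snd q = 0 then (\<Sum>t<n. X $$ (fst q, t) * h $$ (t, b j))
    else h $$ (fst q, b j))" for q :: "nat \<times> nat" and j
  have finA: "finite ?A" "finite ?E" by auto
  have "card ?A \<le> card (A \<inter> {z..<c})" using fin by (intro card_inj_on_le[of Suc]) auto
  moreover have "card ?E \<le> card (E \<inter> {c..e})" using fin by (intro card_inj_on_le[of Suc]) auto
  moreover have "card ?Q \<le> card ?A + card ?E"
    using card_Un_le[of "(\<lambda>s. (s, 0 :: nat)) ` ?A" "(\<lambda>t. (t, 1)) ` ?E"]
      card_image_le[OF finA(1), of "\<lambda>s. (s, 0 :: nat)"] card_image_le[OF finA(2), of "\<lambda>t. (t, 1 :: nat)"] by linarith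
  ultimately have Q: "finite ?Q" "card ?Q < r" using less by auto
  have "Y $$ (a i, b j) = (\<Sum>q\<in>?Q. u q i * v q j)" if ij: "i < r" "j < r" for i j
  proof -
    have ab: "a i < n" "b j < n" using a b ij by auto
    let ?F = "\<lambda>s t. g $$ (a i, s) * X $$ (s, t) * h $$ (t, b j)"
    have "Y $$ (a i, b j) = (\<Sum>s<n. \<Sum>t<n. ?F s t)"
      unfolding *(7) index_mult3_mat_sum[OF *(2) X *(3) ab] by (rule sum.swap)
    also have "\<dots> = (\<Sum>s<n. (\<Sum>t<n. if Suc s < c then ?F s t else 0) + (\<Sum>t<n. if Suc s < c then 0 else ?F s t))"
    proof (rule sum.cong[OF refl])
      fix s
      show "(\<Sum>t<n. ?F s t) =
          (\<Sum>t<n. if Suc s < c then ?F s t else 0) + (\<Sum>t<n. if Suc s < c then 0 else ?F s t)"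
        by (cases "Suc s < c") simp_all
    qed
    also have "\<dots> = (\<Sum>s<n. \<Sum>t<n. if Suc s < c then ?F s t else 0)
        + (\<Sum>t<n. \<Sum>s<n. if Suc s < c then 0 else ?F s t)"
      unfolding sum.distrib
      using sum.swap[of "\<lambda>s t. if Suc s < c then 0 else ?F s t" "{..<n}" "{..<n}"] by (simp only:)
    also have "(\<Sum>s<n. \<Sum>t<n. if Suc s < c then ?F s t else 0) = (\<Sum>s\<in>?A. u (s, 0) i * v (s, 0) j)"
    proof (rule sum.mono_neutral_cong_right)
      show "\<forall>s\<in>{..<n} - ?A. (\<Sum>t<n. if Suc s < c then ?F s t else 0) = 0"
      proof (intro ballI sum.neutral)
        fix s t assume st: "s \<in> {..<n} - ?A" "t \<in> {..<n}"
        show "(if Suc s < c then ?F s t else 0) = 0"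
          using st l[of s t] g0[OF ij(1), of s] unfolding linked_def by (cases "X $$ (s, t) = 0") auto
      qed
      show "(\<Sum>t<n. if Suc s < c then ?F s t else 0) = u (s, 0) i * v (s, 0) j" if "s \<in> ?A" for s
        using that by (auto simp: u_def v_def sum_distrib_left mult_ac intro!: sum.cong)
    qed auto
    also have "(\<Sum>t<n. \<Sum>s<n. if Suc s < c then 0 else ?F s t) = (\<Sum>t\<in>?E. u (t, 1) i * v (t, 1) j)"
    proof (rule sum.mono_neutral_cong_right)
      show "\<forall>t\<in>{..<n} - ?E. (\<Sum>s<n. if Suc s < c then 0 else ?F s t) = 0"
      proof (intro ballI sum.neutral)
        fix t s assume st: "t \<in> {..<n} - ?E" "s \<in> {..<n}"
        show "(if Suc s < c then 0 else ?F s t) = 0"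
          using st l[of s t] h0[OF ij(2), of t] unfolding linked_def by (cases "X $$ (s, t) = 0") auto
      qed
      show "(\<Sum>s<n. if Suc s < c then 0 else ?F s t) = u (t, 1) i * v (t, 1) j" if "t \<in> ?E" for t
        by (auto simp: u_def v_def sum_distrib_right intro!: sum.cong)
    qed auto
    also have "(\<Sum>s\<in>?A. u (s, 0) i * v (s, 0) j) = (\<Sum>q\<in>(\<lambda>s. (s, 0 :: nat)) ` ?A. u q i * v q j)"
      by (subst sum.reindex) (auto simp: inj_on_def)
    also have "(\<Sum>t\<in>?E. u (t, 1) i * v (t, 1) j) = (\<Sum>q\<in>(\<lambda>t. (t, 1 :: nat)) ` ?E. u q i * v q j)"
      by (subst sum.reindex) (auto simp: inj_on_def)
    also have "(\<Sum>q\<in>(\<lambda>s. (s, 0 :: nat)) ` ?A. u q i * v q j) + (\<Sum>q\<in>(\<lambda>t. (t, 1 :: nat)) ` ?E. u q i * v q j)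
        = (\<Sum>q\<in>?Q. u q i * v q j)"
      by (rule sum.union_disjoint[symmetric]) auto
    finally show ?thesis .
  qed
  then have "mat r r (\<lambda>(i, j). Y $$ (a i, b j)) = mat r r (\<lambda>(i, j). \<Sum>q\<in>?Q. u q i * v q j)"
    by (intro eq_matI) auto
  then show ?thesis unfolding minor_def using det_sum_rank_one[OF Q, of u v] by simp
qed

text \<open>One minor is tested on both sides. Its rows and columns come from the linked pairs of
  the balanced interval, so it is 1 at a matrix of the first space, while a smaller cut of
  \<open>(A', E')\<close> would make it vanish on the saturation of the second and on its
  closure.\<close>

lemma columns_mats_cut:
  assumes sub: "columns_mats n A E \<subseteq> zariski_closure n (conjugates n (Borel n) (columns_mats n A' E'))"
    and S: "A \<inter> E = {}" "A \<union> E = {1..n}" and T: "A' \<inter> E' = {}" "A' \<union> E' = {1..n}"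
    and d: "dyck_interval A E z e" "1 \<le> z" "e \<le> n"
  shows "card (A \<inter> {z..e}) \<le> card (A' \<inter> {z..<c}) + card (E' \<inter> {c..e})"
proof (rule ccontr)
  let ?r = "card (A \<inter> {z..e})"
  assume "\<not> ?r \<le> card (A' \<inter> {z..<c}) + card (E' \<inter> {c..e})"
  then have less: "card (A' \<inter> {z..<c}) + card (E' \<inter> {c..e}) < ?r" by simp
  obtain h k where hk: "bij_betw h {..<?r} (A \<inter> {z..e})" "bij_betw k {..<?r} (E \<inter> {z..e})"
    "\<And>i. i < ?r \<Longrightarrow> linked A E (h i) (k i)"
    using dyck_interval_linked_pairs[OF d(1) S(1)] by metis
  have mem: "h i \<in> {z..e}" "k i \<in> {z..e}" if "i < ?r" for i
    using bij_betwE[OF hk(1)] bij_betwE[OF hk(2)] that by auto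
  define a where "a i = h i - 1" for i
  define b where "b i = k i - 1" for i
  have Suc: "Suc (a i) = h i" "Suc (b i) = k i" if "i < ?r" for i
    using mem[OF that] d(2) by (auto simp: a_def b_def)
  have lt: "a i < n \<and> b i < n" if "i < ?r" for i
    using Suc[OF that] mem[OF that] d(3) by auto
  have inj: "inj_on a {..<?r}" "inj_on b {..<?r}"
    using hk(1,2) Suc unfolding bij_betw_def inj_on_def by (metis lessThan_iff)+
  let ?M = "(\<lambda>i. (a i, b i)) ` {..<?r}"
  have "linked A E (Suc p) (Suc q)" if pq: "(p, q) \<in> ?M" for p q
    using pq hk(3) Suc by auto
  then have "matching_mat n ?M \<in> columns_mats n A E"
    unfolding columns_mats_def by (rule matching_mat_supported)
  then have N: "matching_mat n ?M \<in> zariski_closure n (conjugates n (Borel n) (columns_mats n A' E'))"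
    using sub by blast
  have cc: "conjugates n (Borel n) (columns_mats n A' E') \<subseteq> carrier_mat n n"
    unfolding columns_mats_def by (intro conjugates_carrier Borel_carrier supported_mats_carrier)
  have fin: "finite A'" "finite E'" using T(2) by (metis finite_Un finite_atLeastAtMost)+
  have "minor ?r a b Y = 0" if "Y \<in> conjugates n (Borel n) (columns_mats n A' E')" for Y
    by (rule minor_cut[OF that T(1) fin _ _ less]) (use lt Suc mem in auto)
  moreover have "minor ?r a b \<in> polynomial_functions n" using lt by (rule minor_polynomial)
  ultimately have "minor ?r a b (matching_mat n ?M) = 0" using zariski_closureD[OF N cc] by blast
  then show False using minor_matching_mat[OF inj lt] by simp
qed

lemma columns_mats_closure_imp_subset:
  assumes S: "two_columns C D w" "set w = {1..n}" and T: "two_columns C' D' w'" "set w' = {1..n}"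
    and sub: "columns_mats n (set C) (set D) \<subseteq>
      zariski_closure n (conjugates n (Borel n) (columns_mats n (set C') (set D')))"
  shows "columns_mats n (set C) (set D) \<subseteq> columns_mats n (set C') (set D')"
proof -
  note tS = two_columns_basic[OF S(1)] and tT = two_columns_basic[OF T(1)]
  have u: "set C \<union> set D = {1..n}" "set C' \<union> set D' = {1..n}" using tS(2) tT(2) S(2) T(2) by auto
  have "linked (set C') (set D') x y" if "linked (set C) (set D) x y" for x y
    by (rule linked_transfer[OF finite_set finite_set tS(3) u(1) two_columns_ballot[OF S(1)] tT(3) u(2) _ that])
      (rule columns_mats_cut[OF sub tS(3) u(1) tT(3) u(2)])
  then show ?thesis unfolding columns_mats_def supported_mats_def by blast
qed

theorem corollary3p13:
  fixes n :: nat and T S :: tableau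
  assumes "n \<ge> 1"
    and "T \<in> two_column_tableaux n"
    and "S \<in> two_column_tableaux n"
  shows "orbital_variety n S \<subseteq> zariski_closure n (orbital_variety n T) \<longleftrightarrow>
    nil_inter n (word_of_tableau n S) \<subseteq> nil_inter n (word_of_tableau n T)"
proof -
  obtain C D w where S: "S = tableau_of_columns C D" "two_columns C D w" "set w = {1..n}"
    "w = word_of_tableau n S" using two_column_tableaux_cases[OF assms(3)] by metis
  obtain C' D' w' where T: "T = tableau_of_columns C' D'" "two_columns C' D' w'" "set w' = {1..n}"
    "w' = word_of_tableau n T" using two_column_tableaux_cases[OF assms(2)] by metis
  have V: "orbital_variety n S = orbital_variety_of_word n w" "orbital_variety n T = orbital_variety_of_word n w'"
    using orbital_variety_eq[OF two_columns_basic(1)[OF S(2)] S(3)] tableau_of_word_two_columns[OF S(2)] S(1)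
      orbital_variety_eq[OF two_columns_basic(1)[OF T(2)] T(3)] tableau_of_word_two_columns[OF T(2)] T(1)
    by simp_all
  note clS = orbital_variety_closure[OF assms(1) S(2,3)] and clT = orbital_variety_closure[OF assms(1) T(2,3)]
  have "orbital_variety_of_word n w \<subseteq> zariski_closure n (orbital_variety_of_word n w') \<longleftrightarrow>
      nil_inter n w \<subseteq> nil_inter n w'"
  proof
    assume "orbital_variety_of_word n w \<subseteq> zariski_closure n (orbital_variety_of_word n w')"
    \<comment> \<open>The space contains the zero matrix and thus need not lie in the variety
      itself, so the inclusion is first passed to closures.\<close>
    then have "Borel_closure n w \<subseteq> Borel_closure n w'"
      using zariski_closure_least clS clT by metis
    moreover have "nil_inter n w \<subseteq> Borel_closure n w"
      using subset_conjugates_Borel[OF nil_inter_carrier] zariski_closure_subset by blast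
    ultimately show "nil_inter n w \<subseteq> nil_inter n w'"
      using columns_mats_closure_imp_subset[OF S(2,3) T(2,3)]
      unfolding nil_inter_two_columns[OF S(2,3)] nil_inter_two_columns[OF T(2,3)] by blast
  next
    assume "nil_inter n w \<subseteq> nil_inter n w'"
    then have "conjugates n (Borel n) (nil_inter n w) \<subseteq> conjugates n (Borel n) (nil_inter n w')"
      by (intro conjugates_mono) auto
    then have "Borel_closure n w \<subseteq> Borel_closure n w'"
      using zariski_closure_subset zariski_closure_least by (metis subset_trans)
    then show "orbital_variety_of_word n w \<subseteq> zariski_closure n (orbital_variety_of_word n w')"
      using clS clT zariski_closure_subset by blast
  qed
  then show ?thesis unfolding V S(4)[symmetric] T(4)[symmetric] .
qed

end
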